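(* Let $M\subset\mathbb{C}$ be a simply connected domain, $z_0\in M$ a base point, and $X\colon M\to\mathbb{R}^4$ a smooth map. Then $X$ is a conformal minimal immersion if and only if, for any fixed non-zero null element $L_0\in\mathbb{H}_{\mathbb{C}}$, there exist holomorphic maps $A,B\colon M\to\operatorname{Sp}(1,\mathbb{C})$ and a constant $c\in\mathbb{R}^4$ such that $$X(z)=c+\operatorname{Re}\int_{z_0}^{z}A(\zeta)\,L_0\,B(\zeta)\,\mathrm{d}\zeta \qquad (z\in M).$$ Equivalently, $X$ is a conformal minimal immersion if and only if there exist holomorphic maps $A,B\colon M\to\operatorname{Sp}(1,\mathbb{C})$, a holomorphic map $L\colon M\to\mathbb{H}_{\mathbb{C}}\setminus\{0\}$ with $L(z)^s=0$ for all $z\in M$, and $c\in\mathbb{R}^4$ such that $$X(z)=c+\operatorname{Re}\int_{z_0}^{z}A(\zeta)\,L(\zeta)\,B(\zeta)\,\mathrm{d}\zeta\qquad (z\in M).$$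
   Context: $\mathbb{H}_{\mathbb{C}}:=\mathbb{H}\otimes_{\mathbb{R}}\mathbb{C}$ is the algebra of complex quaternions: elements $q=q_0+q_1e_1+q_2e_2+q_3e_3$ with $q_j\in\mathbb{C}$, where the imaginary unit $\mathrm{i}\in\mathbb{C}$ commutes with $e_1,e_2,e_3$, and $e_1^2=e_2^2=e_3^2=-1$, $e_1e_2=e_3=-e_2e_1$, $e_2e_3=e_1=-e_3e_2$, $e_3e_1=e_2=-e_1e_3$. The conjugate is $q^c:=q_0-q_1e_1-q_2e_2-q_3e_3$ and the symmetrised norm is $q^s:=qq^c=q_0^2+q_1^2+q_2^2+q_3^2\in\mathbb{C}$. An element $q$ is null if $q^s=0$. $\operatorname{Sp}(1,\mathbb{C}):=\{q\in\mathbb{H}_{\mathbb{C}}: q^s=1\}$. $\mathbb{H}_{\mathbb{C}}$ is identified with $\mathbb{C}^4$ via $q\leftrightarrow(q_0,q_1,q_2,q_3)$, and $\operatorname{Re}$ denotes the componentwise real part $\mathbb{C}^4\to\mathbb{R}^4$. With $z=u+\mathrm{i}v$, an immersion $X\colon M\to\mathbb{R}^4$ is conformal if $\langle X_u,X_u\rangle=\langle X_v,X_v\rangle$ and $\langle X_u,X_v\rangle=0$ (Euclidean inner product), and a conformal immersion is minimal if its mean curvature vector vanishes, equivalently $X_{uu}+X_{vv}=0$. *)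

theory Defs
  imports "HOL-Complex_Analysis.Complex_Analysis"
begin

section \<open>Complex quaternions\<close>

datatype cquat = CQuat (Q0: complex) (Q1: complex) (Q2: complex) (Q3: complex)

lemma cquat_eq_iff: "p = q \<longleftrightarrow> Q0 p = Q0 q \<and> Q1 p = Q1 q \<and> Q2 p = Q2 q \<and> Q3 p = Q3 q"
  by (cases p; cases q) simp

instantiation cquat :: ring_1
begin

definition "0 = CQuat 0 0 0 0"
definition "1 = CQuat 1 0 0 0"
definition "p + q = CQuat (Q0 p + Q0 q) (Q1 p + Q1 q) (Q2 p + Q2 q) (Q3 p + Q3 q)"
definition "- q = CQuat (- Q0 q) (- Q1 q) (- Q2 q) (- Q3 q)"
definition "p - q = CQuat (Q0 p - Q0 q) (Q1 p - Q1 q) (Q2 p - Q2 q) (Q3 p - Q3 q)"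
definition "p * q = CQuat
    (Q0 p * Q0 q - Q1 p * Q1 q - Q2 p * Q2 q - Q3 p * Q3 q)
    (Q0 p * Q1 q + Q1 p * Q0 q + Q2 p * Q3 q - Q3 p * Q2 q)
    (Q0 p * Q2 q - Q1 p * Q3 q + Q2 p * Q0 q + Q3 p * Q1 q)
    (Q0 p * Q3 q + Q1 p * Q2 q - Q2 p * Q1 q + Q3 p * Q0 q)"

lemmas cquat_ops = zero_cquat_def one_cquat_def plus_cquat_def uminus_cquat_def
  minus_cquat_def times_cquat_def

instance
  by standard (simp_all add: cquat_ops cquat_eq_iff algebra_simps)

end

definition cquat_of_complex :: "complex \<Rightarrow> cquat"
  where "cquat_of_complex a = CQuat a 0 0 0"

definition e1 :: cquat where "e1 = CQuat 0 1 0 0"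
definition e2 :: cquat where "e2 = CQuat 0 0 1 0"
definition e3 :: cquat where "e3 = CQuat 0 0 0 1"

text \<open>The multiplication above is the one of \<open>\<H> \<otimes> \<complex>\<close>: complex scalars are central and the
  basis obeys Hamilton's relations.\<close>

lemma cquat_basis_expansion:
  "q = cquat_of_complex (Q0 q) + cquat_of_complex (Q1 q) * e1
     + cquat_of_complex (Q2 q) * e2 + cquat_of_complex (Q3 q) * e3"
  by (simp add: cquat_ops cquat_eq_iff cquat_of_complex_def e1_def e2_def e3_def)

lemma cquat_of_complex_central: "cquat_of_complex a * q = q * cquat_of_complex a"
  by (simp add: cquat_ops cquat_eq_iff cquat_of_complex_def)

lemma cquat_of_complex_hom:
  "cquat_of_complex (a + b) = cquat_of_complex a + cquat_of_complex b"
  "cquat_of_complex (a * b) = cquat_of_complex a * cquat_of_complex b"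
  "cquat_of_complex 1 = 1"
  by (simp_all add: cquat_ops cquat_eq_iff cquat_of_complex_def)

lemma cquat_basis_mult:
  "e1 * e1 = - 1" "e2 * e2 = - 1" "e3 * e3 = - 1"
  "e1 * e2 = e3" "e2 * e1 = - e3"
  "e2 * e3 = e1" "e3 * e2 = - e1"
  "e3 * e1 = e2" "e1 * e3 = - e2"
  by (simp_all add: cquat_ops cquat_eq_iff e1_def e2_def e3_def)

definition cquat_cnj :: "cquat \<Rightarrow> cquat"
  where "cquat_cnj q = CQuat (Q0 q) (- Q1 q) (- Q2 q) (- Q3 q)"

definition symnorm :: "cquat \<Rightarrow> complex"
  where "symnorm q = (Q0 q)\<^sup>2 + (Q1 q)\<^sup>2 + (Q2 q)\<^sup>2 + (Q3 q)\<^sup>2"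

lemma mult_cquat_cnj: "q * cquat_cnj q = cquat_of_complex (symnorm q)"
  by (simp add: cquat_ops cquat_eq_iff cquat_cnj_def symnorm_def cquat_of_complex_def
      power2_eq_square algebra_simps)

definition null_cquat :: "cquat \<Rightarrow> bool"
  where "null_cquat q \<longleftrightarrow> symnorm q = 0"

definition Sp1C :: "cquat set"
  where "Sp1C = {q. symnorm q = 1}"

text \<open>The coordinates \<open>q\<^sub>0, \<dots>, q\<^sub>3\<close> sit at the indices \<open>1, \<dots>, 4\<close> of the vector.\<close>

definition cquat_vec :: "cquat \<Rightarrow> complex ^ 4"
  where "cquat_vec q = vector [Q0 q, Q1 q, Q2 q, Q3 q]"

definition Re_vec :: "complex ^ 'n \<Rightarrow> real ^ 'n"
  where "Re_vec w = (\<chi> i. Re (w $ i))"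

definition cquat_holomorphic_on :: "(complex \<Rightarrow> cquat) \<Rightarrow> complex set \<Rightarrow> bool"
  where "cquat_holomorphic_on F M \<longleftrightarrow> (\<forall>i. (\<lambda>z. cquat_vec (F z) $ i) holomorphic_on M)"

definition cquat_contour_integral :: "(real \<Rightarrow> complex) \<Rightarrow> (complex \<Rightarrow> cquat) \<Rightarrow> complex ^ 4"
  where "cquat_contour_integral \<gamma> F = (\<chi> i. contour_integral \<gamma> (\<lambda>\<zeta>. cquat_vec (F \<zeta>) $ i))"

text \<open>The formula \<open>X(z) = c + Re \<integral> F\<close>, the integral running from \<open>z\<^sub>0\<close> to \<open>z\<close>. It is required along
  every piecewise \<open>C\<^sup>1\<close> path in \<open>M\<close>; for \<open>F\<close> holomorphic on a simply connected domain the integral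
  does not depend on the path.\<close>

definition Re_integral_rep ::
  "complex set \<Rightarrow> complex \<Rightarrow> (complex \<Rightarrow> real ^ 4) \<Rightarrow> real ^ 4 \<Rightarrow> (complex \<Rightarrow> cquat) \<Rightarrow> bool"
  where "Re_integral_rep M z0 X c F \<longleftrightarrow>
    (\<forall>z\<in>M. \<forall>\<gamma>. valid_path \<gamma> \<and> path_image \<gamma> \<subseteq> M \<and> pathstart \<gamma> = z0 \<and> pathfinish \<gamma> = z
        \<longrightarrow> X z = c + Re_vec (cquat_contour_integral \<gamma> F))"


section \<open>Smooth maps and surfaces\<close>

text \<open>On open sets, \<open>Ck_on k f S\<close> says that \<open>f\<close> is \<open>k\<close> times continuously differentiable in the
  real sense, through iterated directional derivatives.\<close>

fun Ck_on :: "nat \<Rightarrow> ('a::real_normed_vector \<Rightarrow> 'b::real_normed_vector) \<Rightarrow> 'a set \<Rightarrow> bool" where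
  "Ck_on 0 f S \<longleftrightarrow> continuous_on S f"
| "Ck_on (Suc k) f S \<longleftrightarrow> (\<forall>x\<in>S. f differentiable (at x)) \<and>
     (\<forall>v. Ck_on k (\<lambda>x. frechet_derivative f (at x) v) S)"

definition smooth_map_on :: "('a::real_normed_vector \<Rightarrow> 'b::real_normed_vector) \<Rightarrow> 'a set \<Rightarrow> bool"
  where "smooth_map_on f S \<longleftrightarrow> (\<forall>k. Ck_on k f S)"

text \<open>Partial derivatives with respect to the real coordinates of \<open>z = u + \<i>v\<close>.\<close>

definition d_u :: "(complex \<Rightarrow> 'b::real_normed_vector) \<Rightarrow> complex \<Rightarrow> 'b"
  where "d_u X z = frechet_derivative X (at z) 1"

definition d_v :: "(complex \<Rightarrow> 'b::real_normed_vector) \<Rightarrow> complex \<Rightarrow> 'b"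
  where "d_v X z = frechet_derivative X (at z) \<i>"

definition immersion_on :: "complex set \<Rightarrow> (complex \<Rightarrow> 'b::real_normed_vector) \<Rightarrow> bool"
  where "immersion_on M X \<longleftrightarrow>
    (\<forall>z\<in>M. X differentiable (at z) \<and> inj (frechet_derivative X (at z)))"

definition conformal_on :: "complex set \<Rightarrow> (complex \<Rightarrow> 'b::real_inner) \<Rightarrow> bool"
  where "conformal_on M X \<longleftrightarrow>
    (\<forall>z\<in>M. d_u X z \<bullet> d_u X z = d_v X z \<bullet> d_v X z \<and> d_u X z \<bullet> d_v X z = 0)"

definition tangent_plane :: "(complex \<Rightarrow> 'b::euclidean_space) \<Rightarrow> complex \<Rightarrow> 'b set"
  where "tangent_plane X z = span {d_u X z, d_v X z}"

definition normal_part :: "(complex \<Rightarrow> 'b::euclidean_space) \<Rightarrow> complex \<Rightarrow> 'b \<Rightarrow> 'b"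
  where "normal_part X z w =
    (THE n. n \<in> orthogonal_comp (tangent_plane X z) \<and> w - n \<in> tangent_plane X z)"

text \<open>Half the trace of the second fundamental form with respect to the first one
  \<open>E du\<^sup>2 + 2 F du dv + G dv\<^sup>2\<close>, for an arbitrary immersion.\<close>

definition mean_curvature_vector :: "(complex \<Rightarrow> 'b::euclidean_space) \<Rightarrow> complex \<Rightarrow> 'b"
  where "mean_curvature_vector X z =
    (let E = d_u X z \<bullet> d_u X z; F = d_u X z \<bullet> d_v X z; G = d_v X z \<bullet> d_v X z;
         II_uu = normal_part X z (d_u (d_u X) z);
         II_uv = normal_part X z (d_u (d_v X) z);
         II_vv = normal_part X z (d_v (d_v X) z)
     in (1 / (2 * (E * G - F\<^sup>2))) *\<^sub>R (G *\<^sub>R II_uu - (2 * F) *\<^sub>R II_uv + E *\<^sub>R II_vv))"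

definition conformal_minimal_immersion_on ::
  "complex set \<Rightarrow> (complex \<Rightarrow> 'b::euclidean_space) \<Rightarrow> bool"
  where "conformal_minimal_immersion_on M X \<longleftrightarrow>
    immersion_on M X \<and> conformal_on M X \<and> (\<forall>z\<in>M. mean_curvature_vector X z = 0)"

end

theory Submission
  imports Defs
begin

text \<open>Writing \<open>f = X\<^sub>u - \<i> X\<^sub>v\<close>, conformality means that \<open>f\<close> is null and immersivity that it has no zero;
  given conformality, vanishing mean curvature is harmonicity, that is, holomorphy of \<open>f\<close>. Hence
  \<open>X = c + Re \<integral> f\<close> with \<open>f\<close> holomorphic, null and nowhere zero, and it remains to write every such
  \<open>f\<close> as \<open>A L\<^sub>0 B\<close>. Under \<open>\<H> \<otimes> \<complex> \<cong> M\<^sub>2(\<complex>)\<close> the symmetrised norm becomes the determinant, so \<open>f\<close>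
  is a matrix of rank one everywhere. It factors as \<open>p q\<^sup>T\<close> with holomorphic nowhere vanishing
  vectors \<open>p\<close> and \<open>q\<close>, and solving the Bezout equations \<open>p \<and> s = 1\<close>, \<open>q \<and> r = 1\<close> completes them to
  matrices of determinant \<open>1\<close>, so that \<open>f = A E B\<close> for a fixed rank one idempotent \<open>E\<close>; the constant
  \<open>L\<^sub>0\<close> factors in the same way, which replaces \<open>E\<close> by \<open>L\<^sub>0\<close>.

  By the Riemann mapping theorem it suffices to factor over the plane or the unit disc. On a relatively
  compact disc only finitely many zeros matter and everything reduces to polynomials; these local
  solutions are glued along an exhaustion by concentric discs by splitting additive cocycles.\<close>

unbundle no fps_syntax

subsection \<open>Divisibility of holomorphic functions near a compact set\<close>

text \<open>The difference quotient extends over \<open>a\<close> with the value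
  \<open>deriv f a\<close>. The factorization holds at every \<open>z\<close>, also outside
  \<open>U\<close>, because it only uses \<open>f a = 0\<close>.\<close>

lemma holomorphic_divide_root:
  assumes "f holomorphic_on U" "open U" "f a = 0"
  obtains g where "g holomorphic_on U" "\<And>z. f z = (z - a) * g z"
proof
  let ?g = "\<lambda>z. if z = a then deriv f a else (f z - f a) / (z - a)"
  show "?g holomorphic_on U"
    by (rule pole_lemma_open[OF assms(1,2)])
  show "f z = (z - a) * ?g z" for z
    using assms(3) by auto
qed

text \<open>Where \<open>f\<close> does not vanish, \<open>g\<close> does; this is a nonempty open
  set, and the identity theorem spreads the zeros over \<open>U\<close>.\<close>

lemma holomorphic_mult_eq_0:
  assumes "f holomorphic_on U" "g holomorphic_on U" "open U" "connected U"
    and "\<And>z. z \<in> U \<Longrightarrow> f z * g z = 0" and "w \<in> U" "f w \<noteq> 0" and "z \<in> U"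
  shows "g z = 0"
proof (rule analytic_continuation_open[of "U \<inter> f -` (- {0})" U g "\<lambda>_. 0"])
  show "open (U \<inter> f -` (- {0}))"
    using assms(1,3) by (intro continuous_open_preimage holomorphic_on_imp_continuous_on) auto
qed (use assms in auto)

text \<open>Induction on the number of distinct zeros in \<open>K\<close>. Each step divides out one
  zero with its full multiplicity, which removes it from the zero set.\<close>

lemma holomorphic_finite_zeros_factor:
  assumes "f holomorphic_on U" "open U" "connected U" "compact K" "K \<subseteq> U" "w \<in> U" "f w \<noteq> 0"
  shows "\<exists>zs u. set zs \<subseteq> K \<and> u holomorphic_on U \<and>
     (\<forall>z\<in>U. f z = (\<Prod>a\<leftarrow>zs. z - a) * u z) \<and> (\<forall>z\<in>K. u z \<noteq> 0)"
  using assms(1,6,7)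
proof (induction "card {z\<in>K. f z = 0}" arbitrary: f w rule: less_induct)
  case less
  show ?case
  proof (cases "{z\<in>K. f z = 0} = {}")
    case True
    then show ?thesis
      using less.prems by (intro exI[of _ "[]"] exI[of _ f]) auto
  next
    case False
    then obtain a where a: "a \<in> K" "f a = 0" by auto
    with assms have "a \<in> U" by auto
    have nc: "\<not> f constant_on U"
    proof
      assume "f constant_on U"
      then have "f w = f a" using less.prems(2) \<open>a \<in> U\<close> unfolding constant_on_def by auto
      then show False using less.prems(3) a by simp
    qed
    have fin: "finite {z\<in>K. f z = 0}"
      using holomorphic_compact_finite_zeros[OF less.prems(1) assms(2,3,4,5) nc] .
    obtain g r n where g: "0 < n" "0 < r" "ball a r \<subseteq> U" "g holomorphic_on ball a r"
      "\<And>z. z \<in> ball a r \<Longrightarrow> f z = (z - a) ^ n * g z" "\<And>z. z \<in> ball a r \<Longrightarrow> g z \<noteq> 0"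
      using holomorphic_factor_zero_nonconstant[OF less.prems(1) assms(2,3) \<open>a \<in> U\<close> a(2) nc] by metis
    \<comment> \<open>Near \<open>a\<close> the quotient is read off from \<open>g\<close>, which
      makes it holomorphic across \<open>a\<close>.\<close>
    define h where "h z = (if z \<in> ball a r then g z else f z / (z - a) ^ n)" for z
    have "h holomorphic_on ball a r"
      using g(4) by (rule holomorphic_transform) (auto simp: h_def)
    moreover have "h holomorphic_on U - {a}"
    proof (rule holomorphic_transform)
      show "(\<lambda>z. f z / (z - a) ^ n) holomorphic_on U - {a}"
        by (intro holomorphic_intros holomorphic_on_subset[OF less.prems(1)]) auto
    qed (auto simp: h_def g)
    ultimately have "h holomorphic_on ball a r \<union> (U - {a})"
      using assms(2) by (intro holomorphic_on_Un) auto
    then have h: "h holomorphic_on U"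
      by (rule holomorphic_on_subset) (use g in auto)
    have fh: "f z = (z - a) ^ n * h z" for z
      using g(2,5) by (cases "z = a") (auto simp: h_def)
    have ha: "h a \<noteq> 0" using g by (auto simp: h_def)
    have "{z\<in>K. h z = 0} \<subset> {z\<in>K. f z = 0}"
      using a ha fh by auto
    then have "card {z\<in>K. h z = 0} < card {z\<in>K. f z = 0}"
      using fin by (rule psubset_card_mono[rotated])
    from less.hyps[OF this h \<open>a \<in> U\<close> ha] obtain zs u where zs: "set zs \<subseteq> K" "u holomorphic_on U"
      "\<forall>z\<in>U. h z = (\<Prod>a\<leftarrow>zs. z - a) * u z" "\<forall>z\<in>K. u z \<noteq> 0" by blast
    show ?thesis
    proof (intro exI conjI)
      show "set (replicate n a @ zs) \<subseteq> K" using zs(1) a by auto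
      show "\<forall>z\<in>U. f z = (\<Prod>b\<leftarrow>replicate n a @ zs. z - b) * u z"
        using zs(3) fh by (auto simp: mult.assoc)
    qed (use zs in auto)
  qed
qed

text \<open>Induction on the roots. If \<open>P * s + f * t = 1\<close>, then
  \<open>(s - k * f, t + k * P)\<close> solves the same equation, and \<open>k\<close> can be chosen
  so that the first entry is divisible by the new factor \<open>z - a\<close>.\<close>

lemma bezout_linear_factors:
  assumes "f holomorphic_on U" "open U" "\<And>a. a \<in> set zs \<Longrightarrow> f a \<noteq> 0"
  shows "\<exists>s t. s holomorphic_on U \<and> t holomorphic_on U \<and>
           (\<forall>z\<in>U. (\<Prod>a\<leftarrow>zs. z - a) * s z + f z * t z = 1)"
  using assms(3)
proof (induction zs)
  case Nil
  show ?case by (intro exI[of _ "\<lambda>_. 1"] exI[of _ "\<lambda>_. 0"]) auto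
next
  case (Cons a zs)
  define P where "P z = (\<Prod>a\<leftarrow>zs. z - a)" for z
  obtain s t where st: "s holomorphic_on U" "t holomorphic_on U" "\<forall>z\<in>U. P z * s z + f z * t z = 1"
    using Cons unfolding P_def by auto
  have P: "P holomorphic_on U"
    unfolding P_def by (induction zs) (auto intro!: holomorphic_intros)
  define k where "k = s a / f a"
  have "s a - k * f a = 0"
    using Cons.prems by (auto simp: k_def)
  then obtain g where g: "g holomorphic_on U" "\<And>z. s z - k * f z = (z - a) * g z"
    using holomorphic_divide_root[OF _ assms(2), of "\<lambda>z. s z - k * f z" a]
      holomorphic_on_diff[OF st(1) holomorphic_on_mult[OF holomorphic_on_const assms(1)]] by blast
  show ?case
  proof (rule exI[of _ g], rule exI[of _ "\<lambda>z. t z + k * P z"], intro conjI ballI)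
    show "(\<lambda>z. t z + k * P z) holomorphic_on U"
      using st P by (intro holomorphic_intros)
    fix z assume "z \<in> U"
    have "(\<Prod>b\<leftarrow>a # zs. z - b) * g z + f z * (t z + k * P z)
        = P z * ((z - a) * g z) + f z * (t z + k * P z)"
      by (simp add: P_def)
    also have "\<dots> = P z * s z + f z * t z"
      unfolding g(2)[symmetric] by (simp add: algebra_simps)
    finally show "(\<Prod>b\<leftarrow>a # zs. z - b) * g z + f z * (t z + k * P z) = 1"
      using st(3) \<open>z \<in> U\<close> by simp
  qed (rule g)
qed

text \<open>Each root \<open>a\<close> is tested against the current cofactor \<open>g\<close>: if
  \<open>g a = 0\<close>, the factor \<open>z - a\<close> passes to the common divisor
  \<open>e\<close>, otherwise \<open>a\<close> is kept in \<open>ys\<close>. Division creates no new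
  zeros of the cofactor, so roots kept earlier stay good.\<close>

lemma gcd_linear_factors:
  assumes "f holomorphic_on U" "open U"
  shows "\<exists>e ys g. e holomorphic_on U \<and> g holomorphic_on U \<and>
           (\<forall>z. (\<Prod>a\<leftarrow>zs. z - a) = e z * (\<Prod>a\<leftarrow>ys. z - a)) \<and>
           (\<forall>z. f z = e z * g z) \<and> (\<forall>a\<in>set ys. g a \<noteq> 0)"
proof (induction zs)
  case Nil
  show ?case
    using assms by (intro exI[of _ "\<lambda>_. 1"] exI[of _ "[]"] exI[of _ f]) auto
next
  case (Cons a zs)
  then obtain e ys g where e: "e holomorphic_on U" "g holomorphic_on U"
    "\<And>z. (\<Prod>a\<leftarrow>zs. z - a) = e z * (\<Prod>a\<leftarrow>ys. z - a)"
    "\<And>z. f z = e z * g z" "\<And>a. a\<in>set ys \<Longrightarrow> g a \<noteq> 0" by blast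
  show ?case
  proof (cases "g a = 0")
    case False
    then show ?thesis
      using e by (intro exI[of _ e] exI[of _ "a # ys"] exI[of _ g]) auto
  next
    case True
    then obtain h where h: "h holomorphic_on U" "\<And>z. g z = (z - a) * h z"
      using holomorphic_divide_root[OF e(2) assms(2)] by metis
    show ?thesis
      using e h by (intro exI[of _ "\<lambda>z. e z * (z - a)"] exI[of _ ys] exI[of _ h])
        (auto intro!: holomorphic_intros)
  qed
qed

text \<open>With \<open>f = P * u\<close>, where \<open>P\<close> is a product of linear factors and
  \<open>u\<close> has no zeros in \<open>K\<close>, a greatest common divisor of \<open>P\<close>
  and \<open>g\<close> serves for \<open>f\<close> and \<open>g\<close>. The situation is symmetric,
  so it does not matter which of them is nonzero at \<open>w\<close>.\<close>

lemma holomorphic_local_gcd: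
  assumes "f holomorphic_on U" "g holomorphic_on U" "open U" "connected U" "compact K" "K \<subseteq> U"
    and "w \<in> U" "f w \<noteq> 0 \<or> g w \<noteq> 0"
  shows "\<exists>e p q. e holomorphic_on U \<and> p holomorphic_on U \<and> q holomorphic_on U \<and>
           (\<forall>z\<in>U. f z = e z * p z \<and> g z = e z * q z) \<and> (\<forall>z\<in>K. p z \<noteq> 0 \<or> q z \<noteq> 0)"
proof -
  have *: "\<exists>e p q. e holomorphic_on U \<and> p holomorphic_on U \<and> q holomorphic_on U \<and>
           (\<forall>z\<in>U. f z = e z * p z \<and> g z = e z * q z) \<and> (\<forall>z\<in>K. p z \<noteq> 0 \<or> q z \<noteq> 0)"
    if f: "f holomorphic_on U" and g: "g holomorphic_on U" and fw: "f w \<noteq> 0" for f g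
  proof -
    obtain zs u where zs: "set zs \<subseteq> K" "u holomorphic_on U"
      "\<And>z. z\<in>U \<Longrightarrow> f z = (\<Prod>a\<leftarrow>zs. z - a) * u z" "\<And>z. z\<in>K \<Longrightarrow> u z \<noteq> 0"
      using holomorphic_finite_zeros_factor[OF f assms(3-7) fw] by blast
    obtain e ys h where e: "e holomorphic_on U" "h holomorphic_on U"
      "\<And>z. (\<Prod>a\<leftarrow>zs. z - a) = e z * (\<Prod>a\<leftarrow>ys. z - a)"
      "\<And>z. g z = e z * h z" "\<And>a. a\<in>set ys \<Longrightarrow> h a \<noteq> 0"
      using gcd_linear_factors[OF g assms(3)] by blast
    have P: "(\<lambda>z. \<Prod>a\<leftarrow>ys. z - a) holomorphic_on U"
      by (induction ys) (auto intro!: holomorphic_intros)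
    show ?thesis
    proof (rule exI[of _ e], rule exI[of _ "\<lambda>z. (\<Prod>a\<leftarrow>ys. z - a) * u z"], rule exI[of _ h],
        intro conjI ballI)
      show "(\<lambda>z. (\<Prod>a\<leftarrow>ys. z - a) * u z) holomorphic_on U"
        by (intro holomorphic_intros P zs)
      show "(\<Prod>a\<leftarrow>ys. z - a) * u z \<noteq> 0 \<or> h z \<noteq> 0" if "z \<in> K" for z
        using zs(4)[OF that] e(5)[of z] by (auto simp: prod_list_zero_iff)
    qed (use e zs in auto)
  qed
  show ?thesis
  proof (cases "f w = 0")
    case False
    then show ?thesis using * assms by blast
  next
    case True
    then show ?thesis using *[of g f] assms by blast
  qed
qed

text \<open>With \<open>f = P * u\<close> as before, \<open>g\<close> has no zero at a root of
  \<open>P\<close>, so \<open>P * s + g * t = 1\<close> can be solved, and \<open>s\<close> is then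
  divided by \<open>u\<close>. As \<open>u\<close> may vanish outside \<open>K\<close>, the solution
  is confined to the interior of \<open>K\<close>.\<close>

lemma holomorphic_local_bezout:
  assumes "f holomorphic_on U" "g holomorphic_on U" "open U" "connected U" "compact K" "K \<subseteq> U"
    and nz: "\<And>z. z \<in> U \<Longrightarrow> f z \<noteq> 0 \<or> g z \<noteq> 0"
  shows "\<exists>s t. s holomorphic_on interior K \<and> t holomorphic_on interior K \<and>
           (\<forall>z\<in>interior K. f z * t z - g z * s z = 1)"
proof (cases "\<exists>w\<in>U. f w \<noteq> 0")
  \<comment> \<open>If \<open>f\<close> vanishes identically, \<open>g\<close> has no zeros and can
    be inverted.\<close>
  case False
  have "g holomorphic_on interior K"
    using assms(2) by (rule holomorphic_on_subset) (use assms(6) interior_subset in blast)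
  moreover have "g z \<noteq> 0" "f z = 0" if "z \<in> interior K" for z
    using that False nz assms(6) interior_subset by blast+
  ultimately show ?thesis
    by (intro exI[of _ "\<lambda>z. - 1 / g z"] exI[of _ "\<lambda>_. 0"]) (auto intro!: holomorphic_intros)
next
  case True
  then obtain w where w: "w \<in> U" "f w \<noteq> 0" by blast
  obtain zs u where zs: "set zs \<subseteq> K" "u holomorphic_on U"
      "\<And>z. z\<in>U \<Longrightarrow> f z = (\<Prod>a\<leftarrow>zs. z - a) * u z" "\<And>z. z\<in>K \<Longrightarrow> u z \<noteq> 0"
    using holomorphic_finite_zeros_factor[OF assms(1,3-6) w] by blast
  have "f a = 0" if "a \<in> set zs" for a
    using that zs(1,3) assms(6) by (subst zs(3)) (auto simp: prod_list_zero_iff)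
  then have "g a \<noteq> 0" if "a \<in> set zs" for a
    using nz[of a] that zs(1) assms(6) by auto
  then obtain s t where st: "s holomorphic_on U" "t holomorphic_on U"
       "\<And>z. z\<in>U \<Longrightarrow> (\<Prod>a\<leftarrow>zs. z - a) * s z + g z * t z = 1"
    using bezout_linear_factors[OF assms(2,3), of zs] by blast
  have sub: "interior K \<subseteq> U" using assms(6) interior_subset by blast
  show ?thesis
  proof (intro exI conjI ballI)
    show "(\<lambda>z. - t z) holomorphic_on interior K"
      by (intro holomorphic_intros holomorphic_on_subset[OF st(2) sub])
    show "(\<lambda>z. s z / u z) holomorphic_on interior K"
      using zs(4) interior_subset
      by (intro holomorphic_intros holomorphic_on_subset[OF st(1) sub] holomorphic_on_subset[OF zs(2) sub]) blast
    fix z assume "z \<in> interior K"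
    then have "z \<in> U" "u z \<noteq> 0" using sub zs(4) interior_subset by blast+
    then show "f z * (s z / u z) - g z * - t z = 1"
      using st(3) zs(3) by simp
  qed
qed

text \<open>The Taylor polynomials at \<open>0\<close> converge uniformly on closed discs of radius
  below the radius of convergence, which is at least \<open>r\<close>.\<close>

lemma holomorphic_polynomial_approx_cball:
  assumes "f holomorphic_on ball 0 r" "\<rho> < r" "\<epsilon> > 0"
  shows "\<exists>g. g holomorphic_on UNIV \<and> (\<forall>z\<in>cball 0 \<rho>. norm (f z - g z) < \<epsilon>)"
proof -
  define c where "c n = (deriv ^^ n) f 0 / fact n" for n
  have sums: "(\<lambda>n. c n * (z - 0) ^ n) sums f z" if "z \<in> ball 0 r" for z
    unfolding c_def using holomorphic_power_series[OF assms(1) that] .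
  have cr: "conv_radius c \<ge> ereal r"
  proof (rule conv_radius_geI_ex')
    fix x assume "0 < x" "ereal x < ereal r"
    then show "summable (\<lambda>n. c n * of_real x ^ n)"
      using sums[of "of_real x"] by (auto simp: sums_iff)
  qed
  have "uniform_limit (cball 0 \<rho>) (\<lambda>n x. \<Sum>i<n. c i * (x - 0) ^ i)
          (\<lambda>x. suminf (\<lambda>i. c i * (x - 0) ^ i)) sequentially"
    using assms(2) cr by (intro powser_uniform_limit) (meson ereal_less_eq less_le_trans ereal_less(2) less_ereal.simps(1))
  then have "\<forall>\<^sub>F n in sequentially. \<forall>x\<in>cball 0 \<rho>. dist (\<Sum>i<n. c i * (x - 0) ^ i) (suminf (\<lambda>i. c i * (x - 0) ^ i)) < \<epsilon>"
    using assms(3) by (rule uniform_limitD)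
  then obtain n where n: "\<forall>x\<in>cball 0 \<rho>. dist (\<Sum>i<n. c i * (x - 0) ^ i) (suminf (\<lambda>i. c i * (x - 0) ^ i)) < \<epsilon>"
    by (auto simp: eventually_sequentially)
  show ?thesis
  proof (intro exI conjI ballI)
    show "(\<lambda>x. \<Sum>i<n. c i * (x - 0) ^ i) holomorphic_on UNIV"
      by (intro holomorphic_intros)
    fix z :: complex assume "z \<in> cball 0 \<rho>"
    moreover from this have "f z = suminf (\<lambda>i. c i * (z - 0) ^ i)"
      using sums[of z] assms(2) by (auto simp: sums_iff)
    ultimately show "norm (f z - (\<Sum>i<n. c i * (z - 0) ^ i)) < \<epsilon>"
      using n by (simp add: dist_norm norm_minus_commute)
  qed
qed

subsection \<open>Gluing along an exhaustion by discs\<close>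

text \<open>Subtracting from \<open>t n\<close> a polynomial that approximates it within \<open>2\<^sup>-\<^sup>n\<close> on the next smaller disc
  makes the series of remainders converge, and the polynomials themselves are entire.\<close>

lemma holomorphic_cocycle_splitting:
  fixes R :: "nat \<Rightarrow> real"
  assumes "strict_mono R" and t: "\<And>n. t n holomorphic_on ball 0 (R (Suc n))"
  shows "\<exists>\<tau>. \<forall>n. \<tau> n holomorphic_on ball 0 (R n) \<and>
           (\<forall>z\<in>ball 0 (R n). \<tau> (Suc n) z - \<tau> n z = t n z)"
proof -
  have "\<exists>g. g holomorphic_on UNIV \<and> (\<forall>z\<in>cball 0 (R n). norm (t n z - g z) < (1/2)^n)" for n
    using assms(1) by (intro holomorphic_polynomial_approx_cball[OF t]) (auto simp: strict_mono_def)
  then obtain P where P: "\<And>n. P n holomorphic_on UNIV"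
      "\<And>n z. z\<in>cball 0 (R n) \<Longrightarrow> norm (t n z - P n z) < (1/2)^n"
    by metis
  define D where "D n z = t n z - P n z" for n z
  have mono: "R m \<le> R n" if "m \<le> n" for m n
    using assms(1) that by (simp add: strict_mono_less_eq)
  have bd: "norm (D (k + n) z) \<le> (1/2)^k" if "z \<in> ball 0 (R n)" for k n z
  proof -
    have "norm (D (k + n) z) < (1/2)^(k + n)"
      unfolding D_def using that mono[of n "k + n"] by (intro P) auto
    also have "\<dots> \<le> (1/2)^k" by (intro power_decreasing) auto
    finally show ?thesis by simp
  qed
  have sm: "summable (\<lambda>k. D (k + n) z)" if "z \<in> ball 0 (R n)" for n z
    by (rule summable_comparison_test[of _ "\<lambda>k. (1/2)^k"]) (use bd[OF that] in auto)
  \<comment> \<open>A telescoping choice: passing from \<open>n\<close> to \<open>n + 1\<close> adds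
    \<open>P n\<close> to the first sum and removes \<open>D n\<close> from the subtracted tail, a
    total change of \<open>P n + D n = t n\<close>.\<close>
  define \<tau> where "\<tau> n z = (\<Sum>k<n. P k z) - (\<Sum>k. D (k + n) z)" for n z
  have hD: "D (k + n) holomorphic_on ball 0 (R n)" for k n
    unfolding D_def using mono[of n "Suc (k + n)"]
    by (intro holomorphic_intros holomorphic_on_subset[OF P(1)] holomorphic_on_subset[OF t]) auto
  have "(\<lambda>z. \<Sum>k. D (k + n) z) holomorphic_on ball 0 (R n)" for n
  proof (rule holomorphic_uniform_sequence)
    show "(\<lambda>z. \<Sum>k<m. D (k + n) z) holomorphic_on ball 0 (R n)" for m
      by (intro holomorphic_intros hD)
    have ul: "uniform_limit (ball 0 (R n)) (\<lambda>m z. \<Sum>k<m. D (k + n) z) (\<lambda>z. \<Sum>k. D (k + n) z) sequentially"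
      by (rule Weierstrass_m_test[of _ _ "\<lambda>k. (1/2)^k"]) (use bd in auto)
    fix x :: complex assume "x \<in> ball 0 (R n)"
    then obtain d where "d > 0" "cball x d \<subseteq> ball 0 (R n)"
      using open_contains_cball[of "ball (0::complex) (R n)"] by blast
    then show "\<exists>d>0. cball x d \<subseteq> ball 0 (R n) \<and>
        uniform_limit (cball x d) (\<lambda>m z. \<Sum>k<m. D (k + n) z) (\<lambda>z. \<Sum>k. D (k + n) z) sequentially"
      using uniform_limit_on_subset[OF ul] by blast
  qed auto
  then have "\<tau> n holomorphic_on ball 0 (R n)" for n
    unfolding \<tau>_def by (intro holomorphic_intros holomorphic_on_subset[OF P(1)]) auto
  moreover have "\<tau> (Suc n) z - \<tau> n z = t n z" if "z \<in> ball 0 (R n)" for n z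
    using suminf_split_head[OF sm[OF that]] unfolding \<tau>_def
    by (simp add: D_def add.commute)
  ultimately show ?thesis by blast
qed

lemma holomorphic_glue_balls:
  fixes R :: "nat \<Rightarrow> real"
  assumes "strict_mono R" and f: "\<And>n. f n holomorphic_on ball 0 (R n)"
    and step: "\<And>n z. z \<in> ball 0 (R n) \<Longrightarrow> f (Suc n) z = f n z"
  shows "\<exists>g. g holomorphic_on (\<Union>n. ball 0 (R n)) \<and> (\<forall>n. \<forall>z\<in>ball 0 (R n). g z = f n z)"
proof -
  have mono: "R m \<le> R n" if "m \<le> n" for m n
    using assms(1) that by (simp add: strict_mono_less_eq)
  have le: "f n z = f m z" if "m \<le> n" "z \<in> ball 0 (R m)" for m n z
    using that(1)
  proof (induction rule: dec_induct)
    case (step n)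
    then show ?case using assms(3)[of z n] that(2) mono[of m n] by auto
  qed auto
  \<comment> \<open>The value at \<open>z\<close> is taken from the first disc that contains it; by
    \<open>le\<close> every later disc gives the same value.\<close>
  define g where "g z = f (LEAST n. z \<in> ball 0 (R n)) z" for z
  have g: "g z = f n z" if "z \<in> ball 0 (R n)" for n z
    unfolding g_def using that
    by (intro le[symmetric] Least_le LeastI[of "\<lambda>n. z \<in> ball 0 (R n)" n])
  have "g holomorphic_on (\<Union>n\<in>UNIV. ball 0 (R n))"
  proof (rule holomorphic_on_UN_open)
    show "g holomorphic_on ball 0 (R n)" for n
      using f[of n] by (rule holomorphic_transform) (simp add: g)
  qed auto
  with g show ?thesis by blast
qed

text \<open>Two local solutions of the Bezout equation differ by a multiple of \<open>(f, g)\<close>, so the obstruction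
  to gluing them is an additive cocycle.\<close>

lemma holomorphic_bezout_exhausted:
  fixes R :: "nat \<Rightarrow> real"
  assumes R: "strict_mono R" and S: "S = (\<Union>n. ball 0 (R n))"
    and f: "f holomorphic_on S" and g: "g holomorphic_on S"
    and nz: "\<And>z. z \<in> S \<Longrightarrow> f z \<noteq> 0 \<or> g z \<noteq> 0"
  shows "\<exists>s t. s holomorphic_on S \<and> t holomorphic_on S \<and> (\<forall>z\<in>S. f z * t z - g z * s z = 1)"
proof -
  have mono: "R m < R n" if "m < n" for m n
    using R that by (simp add: strict_mono_less)
  have hol: "f holomorphic_on ball 0 (R n)" "g holomorphic_on ball 0 (R n)" for n
    by (rule holomorphic_on_subset[OF f] holomorphic_on_subset[OF g], use S in blast)+
  have sub: "ball (0::complex) (R n) \<subseteq> ball 0 (R (Suc n))" for n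
    using mono[of n "Suc n"] by auto
  have "\<exists>s t. s holomorphic_on ball 0 (R (Suc n)) \<and> t holomorphic_on ball 0 (R (Suc n)) \<and>
          (\<forall>z\<in>ball 0 (R (Suc n)). f z * t z - g z * s z = 1)" for n
  proof -
    have "f z \<noteq> 0 \<or> g z \<noteq> 0" if "z \<in> ball 0 (R (Suc (Suc n)))" for z
      using nz that unfolding S by blast
    moreover have "cball 0 (R (Suc n)) \<subseteq> ball (0::complex) (R (Suc (Suc n)))"
      using mono[of "Suc n" "Suc (Suc n)"] by auto
    ultimately show ?thesis
      using holomorphic_local_bezout[OF hol(1)[of "Suc (Suc n)"] hol(2)[of "Suc (Suc n)"],
        of "cball 0 (R (Suc n))"] by simp
  qed
  then obtain s t where s: "\<And>n. s n holomorphic_on ball 0 (R (Suc n))"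
    and t: "\<And>n. t n holomorphic_on ball 0 (R (Suc n))"
    and eq: "\<And>n z. z\<in>ball 0 (R (Suc n)) \<Longrightarrow> f z * t n z - g z * s n z = 1"
    by metis
  \<comment> \<open>Both pairs solve the same equation, so their difference is a multiple of
    \<open>(f, g)\<close>; Cramer's rule gives this determinant as the multiplier.\<close>
  define h where "h n z = t n z * s (Suc n) z - s n z * t (Suc n) z" for n z
  have "h n holomorphic_on ball 0 (R (Suc n))" for n
    unfolding h_def using sub[of "Suc n"]
    by (intro holomorphic_intros holomorphic_on_subset[OF s] holomorphic_on_subset[OF t]) auto
  from holomorphic_cocycle_splitting[OF R this] obtain \<tau>
    where \<tau>: "\<And>n. \<tau> n holomorphic_on ball 0 (R n)"
      and \<tau>h: "\<And>n z. z\<in>ball 0 (R n) \<Longrightarrow> \<tau> (Suc n) z - \<tau> n z = h n z" by metis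
  have diff: "s (Suc n) z - s n z = h n z * f z" "t (Suc n) z - t n z = h n z * g z"
    if "z \<in> ball 0 (R n)" for n z
  proof -
    have 1: "f z * t n z - g z * s n z = 1" "f z * t (Suc n) z - g z * s (Suc n) z = 1"
      using that sub[of n] sub[of "Suc n"] by (auto intro!: eq)
    \<comment> \<open>Each term is multiplied by a form of \<open>1\<close> taken from the equation
      of the other solution.\<close>
    have "s (Suc n) z - s n z = s (Suc n) z * (f z * t n z - g z * s n z)
        - s n z * (f z * t (Suc n) z - g z * s (Suc n) z)" using 1 by simp
    then show "s (Suc n) z - s n z = h n z * f z"
      by (simp add: h_def algebra_simps)
    have "t (Suc n) z - t n z = t (Suc n) z * (f z * t n z - g z * s n z)
        - t n z * (f z * t (Suc n) z - g z * s (Suc n) z)" using 1 by simp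
    then show "t (Suc n) z - t n z = h n z * g z"
      by (simp add: h_def algebra_simps)
  qed
  \<comment> \<open>Subtracting \<open>\<tau> n\<close> times \<open>(f, g)\<close> makes
    consecutive pairs agree. The correction cancels in \<open>f * t - g * s\<close>, so the equation
    survives.\<close>
  have "\<exists>s'. s' holomorphic_on S \<and> (\<forall>n. \<forall>z\<in>ball 0 (R n). s' z = s n z - \<tau> n z * f z)"
    unfolding S
  proof (rule holomorphic_glue_balls[OF R])
    show "(\<lambda>z. s n z - \<tau> n z * f z) holomorphic_on ball 0 (R n)" for n
      using holomorphic_on_subset[OF s sub] \<tau> hol by (intro holomorphic_intros)
    show "s (Suc n) z - \<tau> (Suc n) z * f z = s n z - \<tau> n z * f z" if "z \<in> ball 0 (R n)" for n z
      using diff(1)[OF that] \<tau>h[OF that, symmetric] by (simp add: algebra_simps)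
  qed
  moreover have "\<exists>t'. t' holomorphic_on S \<and> (\<forall>n. \<forall>z\<in>ball 0 (R n). t' z = t n z - \<tau> n z * g z)"
    unfolding S
  proof (rule holomorphic_glue_balls[OF R])
    show "(\<lambda>z. t n z - \<tau> n z * g z) holomorphic_on ball 0 (R n)" for n
      using holomorphic_on_subset[OF t sub] \<tau> hol by (intro holomorphic_intros)
    show "t (Suc n) z - \<tau> (Suc n) z * g z = t n z - \<tau> n z * g z" if "z \<in> ball 0 (R n)" for n z
      using diff(2)[OF that] \<tau>h[OF that, symmetric] by (simp add: algebra_simps)
  qed
  ultimately obtain s' t' where s': "s' holomorphic_on S" "t' holomorphic_on S"
    "\<And>n z. z\<in>ball 0 (R n) \<Longrightarrow> s' z = s n z - \<tau> n z * f z"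
    "\<And>n z. z\<in>ball 0 (R n) \<Longrightarrow> t' z = t n z - \<tau> n z * g z" by blast
  have "f z * t' z - g z * s' z = 1" if z: "z \<in> S" for z
  proof -
    obtain n where n: "z \<in> ball 0 (R n)" using z S by blast
    then show ?thesis
      using eq[of z n] sub[of n] by (auto simp: s'(3,4)[OF n] algebra_simps)
  qed
  with s' show ?thesis by blast
qed

text \<open>Two local primitive vectors parallel to \<open>(f, g)\<close> differ by a unit, which on a disc is an
  exponential, so the obstruction is again an additive cocycle. The radii \<open>R (n+3)\<close>, \<open>R (n+2)\<close> and
  \<open>R (n+1)\<close> below leave room for the loss of domain in the two local statements.\<close>

lemma holomorphic_primitive_direction_exhausted:
  fixes R :: "nat \<Rightarrow> real"
  assumes R: "strict_mono R" "R 0 > 0" and S: "S = (\<Union>n. ball 0 (R n))"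
    and f: "f holomorphic_on S" and g: "g holomorphic_on S"
    and w: "w \<in> S" "f w \<noteq> 0 \<or> g w \<noteq> 0"
  shows "\<exists>p q. p holomorphic_on S \<and> q holomorphic_on S \<and> (\<forall>z\<in>S. p z \<noteq> 0 \<or> q z \<noteq> 0) \<and>
           (\<forall>z\<in>S. f z * q z = g z * p z)"
proof -
  have mono: "R m < R n" if "m < n" for m n
    using R that by (simp add: strict_mono_less)
  have sub: "ball (0::complex) (R m) \<subseteq> ball 0 (R n)" if "m \<le> n" for m n
    using mono[of m n] that by (cases "m = n") auto
  have hol: "f holomorphic_on ball 0 (R n)" "g holomorphic_on ball 0 (R n)" for n
    by (rule holomorphic_on_subset[OF f] holomorphic_on_subset[OF g], use S in blast)+
  have S': "open S" "connected S"
  proof -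
    show "open S" unfolding S by auto
    have "0 \<in> ball (0::complex) (R n)" for n using mono[of 0 n] R by (cases "n = 0") auto
    then show "connected S" unfolding S by (intro connected_Union) blast+
  qed
  \<comment> \<open>The pair cannot vanish on a whole disc, since the identity theorem would carry
    the zeros to \<open>w\<close>.\<close>
  have nz: "\<exists>w\<in>ball 0 (R n). f w \<noteq> 0 \<or> g w \<noteq> 0" for n
  proof (rule ccontr)
    assume *: "\<not> ?thesis"
    have ne: "ball (0::complex) (R n) \<noteq> {}" using mono[of 0 n] R by (cases "n = 0") auto
    have "f w = 0"
      by (rule analytic_continuation_open[of "ball 0 (R n)" S f "\<lambda>_. 0"])
        (use * S S' f w ne in auto)
    moreover have "g w = 0"
      by (rule analytic_continuation_open[of "ball 0 (R n)" S g "\<lambda>_. 0"])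
        (use * S S' g w ne in auto)
    ultimately show False using w by simp
  qed
  have "\<exists>e p q. e holomorphic_on ball 0 (R (n+3)) \<and> p holomorphic_on ball 0 (R (n+3)) \<and>
          q holomorphic_on ball 0 (R (n+3)) \<and>
          (\<forall>z\<in>ball 0 (R (n+3)). f z = e z * p z \<and> g z = e z * q z) \<and>
          (\<forall>z\<in>cball 0 (R (n+2)). p z \<noteq> 0 \<or> q z \<noteq> 0)" for n
  proof -
    obtain w where "w \<in> ball 0 (R (n+3))" "f w \<noteq> 0 \<or> g w \<noteq> 0" using nz by blast
    then show ?thesis
      using mono[of "n+2" "n+3"] by (intro holomorphic_local_gcd[OF hol]) auto
  qed
  then obtain e p q where e: "\<And>n. e n holomorphic_on ball 0 (R (n+3))"
    and p: "\<And>n. p n holomorphic_on ball 0 (R (n+3))"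
    and q: "\<And>n. q n holomorphic_on ball 0 (R (n+3))"
    and eq: "\<And>n z. z\<in>ball 0 (R (n+3)) \<Longrightarrow> f z = e n z * p n z \<and> g z = e n z * q n z"
    and pq: "\<And>n z. z\<in>cball 0 (R (n+2)) \<Longrightarrow> p n z \<noteq> 0 \<or> q n z \<noteq> 0" by metis
  have "\<exists>s t. s holomorphic_on ball 0 (R (Suc n)) \<and> t holomorphic_on ball 0 (R (Suc n)) \<and>
          (\<forall>z\<in>ball 0 (R (Suc n)). p n z * t z - q n z * s z = 1)" for n
  proof -
    have "p n holomorphic_on ball 0 (R (n+2))" "q n holomorphic_on ball 0 (R (n+2))"
      using sub[of "n+2" "n+3"]
      by (auto intro: holomorphic_on_subset[OF p] holomorphic_on_subset[OF q])
    moreover have "cball 0 (R (Suc n)) \<subseteq> ball (0::complex) (R (n+2))"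
      using mono[of "Suc n" "n+2"] by auto
    moreover have "p n z \<noteq> 0 \<or> q n z \<noteq> 0" if "z \<in> ball 0 (R (n+2))" for z
      using that by (intro pq) auto
    ultimately show ?thesis
      using holomorphic_local_bezout[of "p n" "ball 0 (R (n+2))" "q n" "cball 0 (R (Suc n))"] by simp
  qed
  then obtain s t where s: "\<And>n. s n holomorphic_on ball 0 (R (Suc n))"
    and t: "\<And>n. t n holomorphic_on ball 0 (R (Suc n))"
    and bez: "\<And>n z. z\<in>ball 0 (R (Suc n)) \<Longrightarrow> p n z * t n z - q n z * s n z = 1"
    by metis
  \<comment> \<open>Both pairs are parallel to \<open>(f, g)\<close>: their determinant times
    \<open>e n * e (Suc n)\<close> is \<open>f * g - g * f = 0\<close>, and that factor is not
    identically zero.\<close>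
  have par: "p n z * q (Suc n) z = q n z * p (Suc n) z" if "z \<in> ball 0 (R (Suc n))" for n z
  proof -
    let ?B = "ball 0 (R (Suc n))"
    have in3: "x \<in> ball 0 (R (n+3))" "x \<in> ball 0 (R (Suc n+3))" if "x \<in> ?B" for x :: complex
      using that sub[of "Suc n" "n+3"] sub[of "Suc n" "Suc n+3"] by auto
    obtain w where w: "w \<in> ?B" "f w \<noteq> 0 \<or> g w \<noteq> 0" using nz by blast
    have "p n z * q (Suc n) z - q n z * p (Suc n) z = 0"
    proof (rule holomorphic_mult_eq_0[of "\<lambda>z. e n z * e (Suc n) z" ?B
          "\<lambda>z. p n z * q (Suc n) z - q n z * p (Suc n) z" w z])
      show "(\<lambda>z. e n z * e (Suc n) z) holomorphic_on ?B"
        "(\<lambda>z. p n z * q (Suc n) z - q n z * p (Suc n) z) holomorphic_on ?B"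
        using in3 by (intro holomorphic_intros holomorphic_on_subset[OF e]
            holomorphic_on_subset[OF p] holomorphic_on_subset[OF q]; blast)+
      show "e n w * e (Suc n) w \<noteq> 0"
        using w eq[OF in3(1)[OF w(1)]] eq[OF in3(2)[OF w(1)]] by auto
      fix x :: complex assume x: "x \<in> ?B"
      have "e n x * e (Suc n) x * (p n x * q (Suc n) x - q n x * p (Suc n) x)
        = (e n x * p n x) * (e (Suc n) x * q (Suc n) x) - (e n x * q n x) * (e (Suc n) x * p (Suc n) x)"
        by (simp add: algebra_simps)
      also have "\<dots> = f x * g x - g x * f x"
        using eq[OF in3(1)[OF x]] eq[OF in3(2)[OF x]] by metis
      finally show "e n x * e (Suc n) x * (p n x * q (Suc n) x - q n x * p (Suc n) x) = 0" by simp
    qed (use w that in auto)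
    then show ?thesis by simp
  qed
  \<comment> \<open>The factor that turns pair \<open>n\<close> into pair \<open>n + 1\<close>,
    extracted with the Bezout coefficients of pair \<open>n\<close>.\<close>
  define l where "l n z = p (Suc n) z * t n z - q (Suc n) z * s n z" for n z
  have lp: "p (Suc n) z = l n z * p n z" "q (Suc n) z = l n z * q n z"
    if "z \<in> ball 0 (R (Suc n))" for n z
  proof -
    have "l n z * p n z = p (Suc n) z * (p n z * t n z) - (p n z * q (Suc n) z) * s n z"
      by (simp add: l_def algebra_simps)
    also have "\<dots> = p (Suc n) z * (p n z * t n z - q n z * s n z)"
      unfolding par[OF that] by (simp add: algebra_simps)
    finally show "p (Suc n) z = l n z * p n z" using bez[OF that] by simp
    have "l n z * q n z = (q n z * p (Suc n) z) * t n z - q (Suc n) z * (q n z * s n z)"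
      by (simp add: l_def algebra_simps)
    also have "\<dots> = q (Suc n) z * (p n z * t n z - q n z * s n z)"
      unfolding par[OF that, symmetric] by (simp add: algebra_simps)
    finally show "q (Suc n) z = l n z * q n z" using bez[OF that] by simp
  qed
  \<comment> \<open>A zero of \<open>l n\<close> would be a common zero of pair
    \<open>n + 1\<close>. So \<open>l n\<close> has no zeros on the disc and possesses a logarithm
    there.\<close>
  have "\<exists>h. h holomorphic_on ball 0 (R (Suc n)) \<and> (\<forall>z\<in>ball 0 (R (Suc n)). l n z = exp (h z))" for n
  proof -
    have "simply_connected (ball 0 (R (Suc n)) :: complex set)"
      by (intro convex_imp_simply_connected) auto
    moreover have "l n holomorphic_on ball 0 (R (Suc n))"
      unfolding l_def using sub[of "Suc n" "Suc n+3"] s t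
      by (intro holomorphic_intros holomorphic_on_subset[OF p] holomorphic_on_subset[OF q]) auto
    moreover have "l n z \<noteq> 0" if "z \<in> ball 0 (R (Suc n))" for z
      using lp[OF that] pq[of z "Suc n"] that sub[of "Suc n" "Suc n+2"] by auto
    ultimately show ?thesis
      using simply_connected_eq_holomorphic_log[of "ball 0 (R (Suc n))"] by auto
  qed
  then obtain h where h: "\<And>n. h n holomorphic_on ball 0 (R (Suc n))"
      "\<And>n z. z\<in>ball 0 (R (Suc n)) \<Longrightarrow> l n z = exp (h n z)" by metis
  from holomorphic_cocycle_splitting[OF R(1) h(1)] obtain \<tau>
    where \<tau>: "\<And>n. \<tau> n holomorphic_on ball 0 (R n)"
      and \<tau>h: "\<And>n z. z\<in>ball 0 (R n) \<Longrightarrow> \<tau> (Suc n) z - \<tau> n z = h n z" by metis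
  \<comment> \<open>Splitting the logarithms additively splits the units multiplicatively, so
    rescaling pair \<open>n\<close> by \<open>exp (- \<tau> n)\<close> makes consecutive pairs
    agree.\<close>
  have ex: "exp (- \<tau> (Suc n) z) * l n z = exp (- \<tau> n z)" if "z \<in> ball 0 (R n)" for n z
  proof -
    have "z \<in> ball 0 (R (Suc n))" using that sub[of n "Suc n"] by auto
    then have "l n z = exp (\<tau> (Suc n) z - \<tau> n z)" by (simp add: h(2) \<tau>h[OF that])
    then show ?thesis by (simp flip: exp_add)
  qed
  have "\<exists>p'. p' holomorphic_on S \<and> (\<forall>n. \<forall>z\<in>ball 0 (R n). p' z = exp (- \<tau> n z) * p n z)"
    unfolding S
  proof (rule holomorphic_glue_balls[OF R(1)])
    show "(\<lambda>z. exp (- \<tau> n z) * p n z) holomorphic_on ball 0 (R n)" for n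
      using sub[of n "n+3"] \<tau> by (intro holomorphic_intros holomorphic_on_subset[OF p]) auto
    show "exp (- \<tau> (Suc n) z) * p (Suc n) z = exp (- \<tau> n z) * p n z" if "z \<in> ball 0 (R n)" for n z
      using that sub[of n "Suc n"] by (auto simp: lp(1) ex[OF that, symmetric])
  qed
  moreover have "\<exists>q'. q' holomorphic_on S \<and> (\<forall>n. \<forall>z\<in>ball 0 (R n). q' z = exp (- \<tau> n z) * q n z)"
    unfolding S
  proof (rule holomorphic_glue_balls[OF R(1)])
    show "(\<lambda>z. exp (- \<tau> n z) * q n z) holomorphic_on ball 0 (R n)" for n
      using sub[of n "n+3"] \<tau> by (intro holomorphic_intros holomorphic_on_subset[OF q]) auto
    show "exp (- \<tau> (Suc n) z) * q (Suc n) z = exp (- \<tau> n z) * q n z" if "z \<in> ball 0 (R n)" for n z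
      using that sub[of n "Suc n"] by (auto simp: lp(2) ex[OF that, symmetric])
  qed
  ultimately obtain p' q' where p': "p' holomorphic_on S" "q' holomorphic_on S"
    "\<And>n z. z\<in>ball 0 (R n) \<Longrightarrow> p' z = exp (- \<tau> n z) * p n z"
    "\<And>n z. z\<in>ball 0 (R n) \<Longrightarrow> q' z = exp (- \<tau> n z) * q n z" by blast
  have "(p' z \<noteq> 0 \<or> q' z \<noteq> 0) \<and> f z * q' z = g z * p' z" if z: "z \<in> S" for z
  proof -
    obtain n where n: "z \<in> ball 0 (R n)" using z S by blast
    then have "z \<in> ball 0 (R (n+3))" "z \<in> cball 0 (R (n+2))"
      using sub[of n "n+3"] sub[of n "n+2"] by auto
    then show ?thesis
      using eq[of z n] pq[of z n] by (auto simp: p'(3,4)[OF n])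
  qed
  with p'(1,2) show ?thesis
    by (intro exI[of _ p'] exI[of _ q']) simp
qed

section \<open>Holomorphic matrices of rank one\<close>

text \<open>The columns \<open>(a, c)\<close> and \<open>(b, d)\<close> are parallel at each point,
  so one nowhere vanishing vector \<open>p\<close> spans both. Their coefficients form
  \<open>q\<close>, and Bezout solutions \<open>s\<close> and \<open>r\<close> complete
  \<open>p\<close> and \<open>q\<close> to matrices of determinant \<open>1\<close>.\<close>

lemma holomorphic_rank_one_factorization_exhausted:
  fixes R :: "nat \<Rightarrow> real"
  assumes R: "strict_mono R" "R 0 > 0" and S: "S = (\<Union>n. ball 0 (R n))"
    and hol: "a holomorphic_on S" "b holomorphic_on S" "c holomorphic_on S" "d holomorphic_on S"
    and det: "\<And>z. z \<in> S \<Longrightarrow> a z * d z = b z * c z"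
    and nz: "\<And>z. z \<in> S \<Longrightarrow> a z \<noteq> 0 \<or> b z \<noteq> 0 \<or> c z \<noteq> 0 \<or> d z \<noteq> 0"
  obtains p1 p2 s1 s2 q1 q2 r1 r2 where
    "p1 holomorphic_on S" "p2 holomorphic_on S" "s1 holomorphic_on S" "s2 holomorphic_on S"
    "q1 holomorphic_on S" "q2 holomorphic_on S" "r1 holomorphic_on S" "r2 holomorphic_on S"
    "\<And>z. z \<in> S \<Longrightarrow> p1 z * s2 z - p2 z * s1 z = 1"
    "\<And>z. z \<in> S \<Longrightarrow> q1 z * r2 z - q2 z * r1 z = 1"
    "\<And>z. z \<in> S \<Longrightarrow> a z = p1 z * q1 z \<and> b z = p1 z * q2 z \<and> c z = p2 z * q1 z \<and> d z = p2 z * q2 z"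
proof -
  have mono: "R m < R n" if "m < n" for m n
    using R that by (simp add: strict_mono_less)
  have 0: "0 \<in> ball (0::complex) (R n)" for n using mono[of 0 n] R by (cases "n = 0") auto
  have S': "open S" "connected S" "0 \<in> S"
  proof -
    show "open S" "0 \<in> S" using 0 unfolding S by auto
    show "connected S" using 0 unfolding S by (intro connected_Union) blast+
  qed
  have "\<exists>p1 p2. p1 holomorphic_on S \<and> p2 holomorphic_on S \<and> (\<forall>z\<in>S. p1 z \<noteq> 0 \<or> p2 z \<noteq> 0) \<and>
           (\<forall>z\<in>S. a z * p2 z = c z * p1 z \<and> b z * p2 z = d z * p1 z)"
  proof -
    \<comment> \<open>The direction of a column \<open>(x, y)\<close> that is nonzero at
      \<open>0\<close> is also that of \<open>(x', y')\<close>: a component of the first column that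
      is nonzero at \<open>0\<close>, multiplied by the determinant in question, gives zero. The
      columns are kept general because either one may vanish at \<open>0\<close>.\<close>
    have *: "\<exists>p1 p2. p1 holomorphic_on S \<and> p2 holomorphic_on S \<and> (\<forall>z\<in>S. p1 z \<noteq> 0 \<or> p2 z \<noteq> 0) \<and>
           (\<forall>z\<in>S. x z * p2 z = y z * p1 z \<and> x' z * p2 z = y' z * p1 z)"
      if h: "x holomorphic_on S" "y holomorphic_on S" "x' holomorphic_on S" "y' holomorphic_on S"
        and par: "\<And>z. z \<in> S \<Longrightarrow> x z * y' z = x' z * y z" and n0: "x 0 \<noteq> 0 \<or> y 0 \<noteq> 0"
      for x y x' y'
    proof -
      obtain p1 p2 where p: "p1 holomorphic_on S" "p2 holomorphic_on S"
        "\<And>z. z\<in>S \<Longrightarrow> p1 z \<noteq> 0 \<or> p2 z \<noteq> 0" "\<And>z. z\<in>S \<Longrightarrow> x z * p2 z = y z * p1 z"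
        using holomorphic_primitive_direction_exhausted[OF R S h(1,2) S'(3) n0] by blast
      have hh: "(\<lambda>z. x' z * p2 z - y' z * p1 z) holomorphic_on S"
        by (intro holomorphic_intros h p)
      have "x' z * p2 z - y' z * p1 z = 0" if z: "z \<in> S" for z
      proof (cases "x 0 = 0")
        case False
        show ?thesis
        proof (rule holomorphic_mult_eq_0[OF h(1) hh S'(1,2) _ S'(3) _ z])
          fix z assume z: "z \<in> S"
          have "x z * (x' z * p2 z - y' z * p1 z) = x' z * (x z * p2 z) - (x z * y' z) * p1 z"
            by (simp add: algebra_simps)
          then show "x z * (x' z * p2 z - y' z * p1 z) = 0"
            unfolding p(4)[OF z] par[OF z] by simp
        qed (rule False)
      next
        case True
        then have "y 0 \<noteq> 0" using n0 by simp
        show ?thesis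
        proof (rule holomorphic_mult_eq_0[OF h(2) hh S'(1,2) _ S'(3) _ z])
          fix z assume z: "z \<in> S"
          have "y z * (x' z * p2 z - y' z * p1 z) = (x' z * y z) * p2 z - y' z * (y z * p1 z)"
            by (simp add: algebra_simps)
          then show "y z * (x' z * p2 z - y' z * p1 z) = 0"
            unfolding p(4)[OF z, symmetric] par[OF z, symmetric] by simp
        qed (rule \<open>y 0 \<noteq> 0\<close>)
      qed
      with p show ?thesis by (intro exI[of _ p1] exI[of _ p2]) auto
    qed
    show ?thesis
    proof (cases "a 0 = 0 \<and> c 0 = 0")
      case False
      then show ?thesis using *[of a c b d] hol det by simp
    next
      case True
      then have "b 0 \<noteq> 0 \<or> d 0 \<noteq> 0" using nz[OF S'(3)] by simp
      then have "\<exists>p1 p2. p1 holomorphic_on S \<and> p2 holomorphic_on S \<and> (\<forall>z\<in>S. p1 z \<noteq> 0 \<or> p2 z \<noteq> 0) \<and>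
           (\<forall>z\<in>S. b z * p2 z = d z * p1 z \<and> a z * p2 z = c z * p1 z)"
        using hol det by (intro *) auto
      then show ?thesis by metis
    qed
  qed
  then obtain p1 p2 where p: "p1 holomorphic_on S" "p2 holomorphic_on S"
      "\<And>z. z\<in>S \<Longrightarrow> p1 z \<noteq> 0 \<or> p2 z \<noteq> 0" 
      "\<And>z. z\<in>S \<Longrightarrow> a z * p2 z = c z * p1 z" "\<And>z. z\<in>S \<Longrightarrow> b z * p2 z = d z * p1 z" by metis
  obtain s1 s2 where s: "s1 holomorphic_on S" "s2 holomorphic_on S"
      "\<And>z. z\<in>S \<Longrightarrow> p1 z * s2 z - p2 z * s1 z = 1"
    using holomorphic_bezout_exhausted[OF R(1) S p(1,2,3)] by blast
  \<comment> \<open>If \<open>(a, c) = q1 * p\<close>, then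
    \<open>s2 * a - s1 * c = q1 * (p1 * s2 - p2 * s1) = q1\<close>; likewise \<open>q2\<close> for
    the second column.\<close>
  define q1 where "q1 z = s2 z * a z - s1 z * c z" for z
  define q2 where "q2 z = s2 z * b z - s1 z * d z" for z
  have q: "q1 holomorphic_on S" "q2 holomorphic_on S"
    unfolding q1_def q2_def by (intro holomorphic_intros s hol)+
  have fac: "x = p1 z * (s2 z * x - s1 z * y)" "y = p2 z * (s2 z * x - s1 z * y)"
    if "x * p2 z = y * p1 z" "z \<in> S" for x y z
  proof -
    have "x = x * (p1 z * s2 z - p2 z * s1 z)" using s(3)[OF that(2)] by simp
    also have "\<dots> = p1 z * s2 z * x - (x * p2 z) * s1 z" by (simp add: algebra_simps)
    finally show "x = p1 z * (s2 z * x - s1 z * y)" unfolding that(1) by (simp add: algebra_simps)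
    have "y = y * (p1 z * s2 z - p2 z * s1 z)" using s(3)[OF that(2)] by simp
    also have "\<dots> = (y * p1 z) * s2 z - p2 z * s1 z * y" by (simp add: algebra_simps)
    finally show "y = p2 z * (s2 z * x - s1 z * y)" unfolding that(1)[symmetric] by (simp add: algebra_simps)
  qed
  have F: "a z = p1 z * q1 z" "b z = p1 z * q2 z" "c z = p2 z * q1 z" "d z = p2 z * q2 z"
    if "z \<in> S" for z
    unfolding q1_def q2_def using fac[OF p(4)[OF that] that] fac[OF p(5)[OF that] that] by auto
  have "q1 z \<noteq> 0 \<or> q2 z \<noteq> 0" if "z \<in> S" for z
    using F[OF that] nz[OF that] by auto
  from holomorphic_bezout_exhausted[OF R(1) S q this] obtain r1 r2 where
    r: "r1 holomorphic_on S" "r2 holomorphic_on S" "\<And>z. z\<in>S \<Longrightarrow> q1 z * r2 z - q2 z * r1 z = 1" by blast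
  show thesis
    by (rule that[OF p(1,2) s(1,2) q r(1,2) s(3) r(3)]) (simp_all add: F)
qed

text \<open>The plane and the unit disc are exhausted by concentric discs. A biholomorphism onto the
  disc transports the factorization, as it consists of pointwise equations between holomorphic
  functions.\<close>

lemma holomorphic_rank_one_factorization:
  assumes S: "open S" "simply_connected S"
    and hol: "a holomorphic_on S" "b holomorphic_on S" "c holomorphic_on S" "d holomorphic_on S"
    and det: "\<And>z. z \<in> S \<Longrightarrow> a z * d z = b z * c z"
    and nz: "\<And>z. z \<in> S \<Longrightarrow> a z \<noteq> 0 \<or> b z \<noteq> 0 \<or> c z \<noteq> 0 \<or> d z \<noteq> 0"
  obtains p1 p2 s1 s2 q1 q2 r1 r2 where
    "p1 holomorphic_on S" "p2 holomorphic_on S" "s1 holomorphic_on S" "s2 holomorphic_on S"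
    "q1 holomorphic_on S" "q2 holomorphic_on S" "r1 holomorphic_on S" "r2 holomorphic_on S"
    "\<And>z. z \<in> S \<Longrightarrow> p1 z * s2 z - p2 z * s1 z = 1"
    "\<And>z. z \<in> S \<Longrightarrow> q1 z * r2 z - q2 z * r1 z = 1"
    "\<And>z. z \<in> S \<Longrightarrow> a z = p1 z * q1 z \<and> b z = p1 z * q2 z \<and> c z = p2 z * q1 z \<and> d z = p2 z * q2 z"
proof -
  consider "S = {}" | "S = UNIV" | (disc) f g where "f holomorphic_on S" "g holomorphic_on ball 0 1"
        "\<And>z. z \<in> S \<Longrightarrow> f z \<in> ball 0 1 \<and> g (f z) = z"
        "\<And>z. z \<in> ball 0 1 \<Longrightarrow> g z \<in> S \<and> f (g z) = z"
    using S simply_connected_eq_biholomorphic_to_disc[OF S(1)] by metis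
  then show ?thesis
  proof cases
    case 1
    show thesis
      by (rule that[OF hol hol]) (simp_all add: 1)
  next
    case 2
    have "z \<in> (\<Union>n. ball 0 (real (Suc n)))" for z :: complex
    proof -
      obtain n where "norm z < real n" using reals_Archimedean2 by blast
      then show ?thesis by (auto intro!: exI[of _ n])
    qed
    then have "S = (\<Union>n. ball 0 (real (Suc n)))" using 2 by auto
    then have SU: "S = (\<Union>n. ball 0 ((\<lambda>n. real (Suc n)) n))" by simp
    have R: "strict_mono (\<lambda>n. real (Suc n))" by (simp add: strict_mono_def)
    show thesis
      by (rule holomorphic_rank_one_factorization_exhausted[OF R _ SU hol det nz]) (simp, assumption+, fact that)
  next
    case disc
    \<comment> \<open>The offset \<open>2\<close> makes the first radius \<open>1 / 2\<close>
      positive, while the radii increase to \<open>1\<close>.\<close>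
    define R where "R n = 1 - 1 / real (n + 2)" for n
    have R: "strict_mono R" "R 0 > 0"
      by (auto simp: R_def strict_mono_def field_simps)
    have "z \<in> (\<Union>n. ball 0 (R n))" if z: "norm z < 1" for z :: complex
    proof -
      obtain n where "inverse (real (Suc n)) < 1 - norm z"
        using z reals_Archimedean[of "1 - norm z"] by auto
      moreover have "1 / real (n + 2) \<le> inverse (real (Suc n))" by (simp add: field_simps)
      ultimately show ?thesis by (intro UN_I[of n]) (auto simp: R_def)
    qed
    moreover have "R n \<le> 1" for n by (simp add: R_def)
    then have "ball 0 (R n) \<subseteq> ball (0::complex) 1" for n
      by (simp add: subset_ball)
    ultimately have B: "ball 0 1 = (\<Union>n. ball (0::complex) (R n))" by auto
    have comp: "(\<lambda>z. h (g z)) holomorphic_on ball 0 1" if "h holomorphic_on S" for h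
      using holomorphic_on_compose_gen[OF disc(2) that] disc(4) by (simp add: o_def image_subset_iff)
    have comp': "(\<lambda>z. h (f z)) holomorphic_on S" if "h holomorphic_on ball 0 1" for h
      using holomorphic_on_compose_gen[OF disc(1) that] disc(3) by (simp add: o_def image_subset_iff)
    have det': "a (g z) * d (g z) = b (g z) * c (g z)"
      and nz': "a (g z) \<noteq> 0 \<or> b (g z) \<noteq> 0 \<or> c (g z) \<noteq> 0 \<or> d (g z) \<noteq> 0" if "z \<in> ball 0 1" for z
      using det nz disc(4)[OF that] by auto
    show thesis
    proof (rule holomorphic_rank_one_factorization_exhausted[OF R B comp[OF hol(1)] comp[OF hol(2)]
          comp[OF hol(3)] comp[OF hol(4)] det' nz'])
      fix p1 p2 s1 s2 q1 q2 r1 r2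
      assume h: "p1 holomorphic_on ball 0 1" "p2 holomorphic_on ball 0 1" "s1 holomorphic_on ball 0 1"
          "s2 holomorphic_on ball 0 1" "q1 holomorphic_on ball 0 1" "q2 holomorphic_on ball 0 1"
          "r1 holomorphic_on ball 0 1" "r2 holomorphic_on ball 0 1"
        and eq: "\<And>z. z \<in> ball 0 1 \<Longrightarrow> p1 z * s2 z - p2 z * s1 z = 1"
          "\<And>z. z \<in> ball 0 1 \<Longrightarrow> q1 z * r2 z - q2 z * r1 z = 1"
          "\<And>z. z \<in> ball 0 1 \<Longrightarrow> a (g z) = p1 z * q1 z \<and> b (g z) = p1 z * q2 z \<and>
            c (g z) = p2 z * q1 z \<and> d (g z) = p2 z * q2 z"
      have f: "f z \<in> ball 0 1" "g (f z) = z" if "z \<in> S" for z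
        using disc(3)[OF that] by auto
      show thesis
      proof (rule that[OF comp'[OF h(1)] comp'[OF h(2)] comp'[OF h(3)] comp'[OF h(4)]
            comp'[OF h(5)] comp'[OF h(6)] comp'[OF h(7)] comp'[OF h(8)]])
        fix z assume "z \<in> S"
        from eq[OF f(1)[OF this]] f(2)[OF this]
        show "p1 (f z) * s2 (f z) - p2 (f z) * s1 (f z) = 1"
          "q1 (f z) * r2 (f z) - q2 (f z) * r1 (f z) = 1"
          "a z = p1 (f z) * q1 (f z) \<and> b z = p1 (f z) * q2 (f z) \<and>
            c z = p2 (f z) * q1 (f z) \<and> d z = p2 (f z) * q2 (f z)"
          by simp_all
      qed
    qed
  qed
qed


subsection \<open>Conformal minimal immersions are harmonic\<close>

lemma symmetric_second_derivative_real:
  fixes g :: "'a::real_normed_vector \<Rightarrow> real"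
  assumes "open M" "z \<in> M"
    and g: "\<And>x. x \<in> M \<Longrightarrow> (g has_derivative g' x) (at x)"
    and ga: "\<And>x. x \<in> M \<Longrightarrow> ((\<lambda>x. g' x a) has_derivative ga x) (at x)"
    and gb: "\<And>x. x \<in> M \<Longrightarrow> ((\<lambda>x. g' x b) has_derivative gb x) (at x)"
    and ca: "continuous_on M (\<lambda>x. ga x b)" and cb: "continuous_on M (\<lambda>x. gb x a)"
  shows "ga z b = gb z a"
proof -
  txt \<open>The mean value theorem, applied in both orders, expresses the second difference of \<open>g\<close> over the
    parallelogram spanned by \<open>t a\<close> and \<open>t b\<close> through either mixed derivative.\<close>
  have line: "((\<lambda>s. f (c + s *\<^sub>R v)) has_field_derivative f' v) (at s)"
    if "(f has_derivative f') (at (c + s *\<^sub>R v))" for f :: "'a \<Rightarrow> real" and f' c v s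
  proof -
    have "((\<lambda>s. c + s *\<^sub>R v) has_derivative (\<lambda>h. h *\<^sub>R v)) (at s)"
      by (auto intro!: derivative_eq_intros)
    from has_derivative_compose[OF this that]
    have "((\<lambda>s. f (c + s *\<^sub>R v)) has_derivative (\<lambda>h. f' (h *\<^sub>R v))) (at s)" .
    moreover have "(\<lambda>h. f' (h *\<^sub>R v)) = (*) (f' v)"
      using linear_scale[OF has_derivative_linear[OF that]] by (simp add: fun_eq_iff)
    ultimately show ?thesis unfolding has_field_derivative_def by simp
  qed
  \<comment> \<open>Kept general in \<open>a\<close>, \<open>b\<close> and \<open>ga\<close>, to be
    used again with the two directions exchanged.\<close>
  have quot: "\<exists>s\<in>{0<..<t}. \<exists>r\<in>{0<..<t}.
      g (z + t *\<^sub>R a + t *\<^sub>R b) - g (z + t *\<^sub>R a) - g (z + t *\<^sub>R b) + g z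
        = t\<^sup>2 * ga (z + s *\<^sub>R a + r *\<^sub>R b) b"
    if t: "t > 0" and sub: "\<And>s r. \<lbrakk>0 \<le> s; s \<le> t; 0 \<le> r; r \<le> t\<rbrakk> \<Longrightarrow> z + s *\<^sub>R a + r *\<^sub>R b \<in> M"
      and ga: "\<And>x. x \<in> M \<Longrightarrow> ((\<lambda>x. g' x a) has_derivative ga x) (at x)"
    for t a b ga
  proof -
    have "\<exists>s>0. s < t \<and> (g (z + t *\<^sub>R b + t *\<^sub>R a) - g (z + t *\<^sub>R a))
        - (g (z + t *\<^sub>R b + 0 *\<^sub>R a) - g (z + 0 *\<^sub>R a))
        = (t - 0) * (g' (z + t *\<^sub>R b + s *\<^sub>R a) a - g' (z + s *\<^sub>R a) a)"
    proof (rule MVT2[OF t])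
      fix s assume "0 \<le> s" "s \<le> t"
      then have "z + t *\<^sub>R b + s *\<^sub>R a \<in> M" "z + s *\<^sub>R a \<in> M"
        using sub[of s t] sub[of s 0] t by (simp_all add: algebra_simps)
      then show "((\<lambda>s. g (z + t *\<^sub>R b + s *\<^sub>R a) - g (z + s *\<^sub>R a)) has_real_derivative
          g' (z + t *\<^sub>R b + s *\<^sub>R a) a - g' (z + s *\<^sub>R a) a) (at s)"
        by (intro DERIV_diff line g)
    qed
    then obtain s where s: "0 < s" "s < t"
      "(g (z + t *\<^sub>R b + t *\<^sub>R a) - g (z + t *\<^sub>R a)) - (g (z + t *\<^sub>R b) - g z)
        = t * (g' (z + t *\<^sub>R b + s *\<^sub>R a) a - g' (z + s *\<^sub>R a) a)" by auto
    have "\<exists>r>0. r < t \<and> g' (z + s *\<^sub>R a + t *\<^sub>R b) a - g' (z + s *\<^sub>R a + 0 *\<^sub>R b) a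
        = (t - 0) * ga (z + s *\<^sub>R a + r *\<^sub>R b) b"
      using sub s by (intro MVT2[OF t] line[of "\<lambda>x. g' x a"] ga) auto
    then obtain r where "0 < r" "r < t"
      "g' (z + s *\<^sub>R a + t *\<^sub>R b) a - g' (z + s *\<^sub>R a) a = t * ga (z + s *\<^sub>R a + r *\<^sub>R b) b" by auto
    with s show ?thesis
      by (intro bexI[of _ s] bexI[of _ r]) (auto simp: power2_eq_square algebra_simps)
  qed
  show ?thesis
  proof (rule ccontr)
    assume ne: "ga z b \<noteq> gb z a"
    \<comment> \<open>Half the gap: numbers within less than \<open>e\<close> of the two mixed
      derivatives cannot coincide.\<close>
    define e where "e = \<bar>ga z b - gb z a\<bar> / 2"
    have "e > 0" using ne by (simp add: e_def)
    obtain d0 where d0: "d0 > 0" "ball z d0 \<subseteq> M"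
      using assms(1,2) openE by blast
    have "\<exists>d>0. \<forall>x\<in>M. dist x z < d \<longrightarrow> dist (ga x b) (ga z b) < e"
      using ca \<open>z \<in> M\<close> \<open>e > 0\<close> unfolding continuous_on_iff by blast
    then obtain d1 where d1: "d1 > 0" "\<And>x. x \<in> M \<Longrightarrow> dist x z < d1 \<Longrightarrow> dist (ga x b) (ga z b) < e" by blast
    have "\<exists>d>0. \<forall>x\<in>M. dist x z < d \<longrightarrow> dist (gb x a) (gb z a) < e"
      using cb \<open>z \<in> M\<close> \<open>e > 0\<close> unfolding continuous_on_iff by blast
    then obtain d2 where d2: "d2 > 0" "\<And>x. x \<in> M \<Longrightarrow> dist x z < d2 \<Longrightarrow> dist (gb x a) (gb z a) < e" by blast
    define d where "d = min d0 (min d1 d2)"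
    \<comment> \<open>With this \<open>N\<close> the parallelogram of side length parameter
      \<open>t = d / (2 * N)\<close> stays within \<open>d / 2\<close> of \<open>z\<close>. The
      summand \<open>1\<close> keeps \<open>N\<close> positive when both directions vanish.\<close>
    define N where "N = norm a + norm b + 1"
    define t where "t = d / (2 * N)"
    have nn: "N > 0"
      using norm_ge_zero[of a] norm_ge_zero[of b] unfolding N_def by linarith
    have "d > 0" using d0 d1 d2 by (simp add: d_def)
    then have "t > 0" using nn by (simp add: t_def)
    have near: "dist (z + s *\<^sub>R a + r *\<^sub>R b) z < d" if "0 \<le> s" "s \<le> t" "0 \<le> r" "r \<le> t" for s r
    proof -
      have "dist (z + s *\<^sub>R a + r *\<^sub>R b) z = norm (s *\<^sub>R a + r *\<^sub>R b)"
        by (simp add: dist_norm)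
      also have "\<dots> \<le> s * norm a + r * norm b"
        using norm_triangle_ineq[of "s *\<^sub>R a" "r *\<^sub>R b"] that by simp
      also have "\<dots> \<le> t * norm a + t * norm b"
        using that by (intro add_mono mult_right_mono) auto
      also have "\<dots> \<le> t * N"
        using \<open>t > 0\<close> by (simp add: N_def algebra_simps)
      also have "\<dots> = d / 2" using nn by (simp add: t_def)
      also have "\<dots> < d" using \<open>d > 0\<close> by simp
      finally show ?thesis .
    qed
    have inM: "z + s *\<^sub>R a + r *\<^sub>R b \<in> M" if "0 \<le> s" "s \<le> t" "0 \<le> r" "r \<le> t" for s r
      using near[OF that] d0(2) by (auto simp: d_def dist_commute)
    have inM': "z + s *\<^sub>R b + r *\<^sub>R a \<in> M" if "0 \<le> s" "s \<le> t" "0 \<le> r" "r \<le> t" for s r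
      using inM[OF that(3,4,1,2)] by (simp add: algebra_simps)
    obtain s r where 1: "s \<in> {0<..<t}" "r \<in> {0<..<t}"
      "g (z + t *\<^sub>R a + t *\<^sub>R b) - g (z + t *\<^sub>R a) - g (z + t *\<^sub>R b) + g z
        = t\<^sup>2 * ga (z + s *\<^sub>R a + r *\<^sub>R b) b"
      using quot[OF \<open>t > 0\<close> inM ga] by blast
    obtain s' r' where 2: "s' \<in> {0<..<t}" "r' \<in> {0<..<t}"
      "g (z + t *\<^sub>R b + t *\<^sub>R a) - g (z + t *\<^sub>R b) - g (z + t *\<^sub>R a) + g z
        = t\<^sup>2 * gb (z + s' *\<^sub>R b + r' *\<^sub>R a) a"
      using quot[OF \<open>t > 0\<close> inM' gb] by blast
    have c: "z + t *\<^sub>R b + t *\<^sub>R a = z + t *\<^sub>R a + t *\<^sub>R b" by (simp add: algebra_simps)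
    have "t\<^sup>2 * ga (z + s *\<^sub>R a + r *\<^sub>R b) b = t\<^sup>2 * gb (z + s' *\<^sub>R b + r' *\<^sub>R a) a"
      using 1(3) 2(3)[unfolded c] by linarith
    then have eq: "ga (z + s *\<^sub>R a + r *\<^sub>R b) b = gb (z + s' *\<^sub>R b + r' *\<^sub>R a) a"
      using \<open>t > 0\<close> by simp
    have "dist (ga (z + s *\<^sub>R a + r *\<^sub>R b) b) (ga z b) < e"
      using 1 near[of s r] by (intro d1 inM) (auto simp: d_def)
    moreover have "dist (gb (z + s' *\<^sub>R b + r' *\<^sub>R a) a) (gb z a) < e"
      using 2 near[of r' s'] by (intro d2 inM') (auto simp: d_def algebra_simps)
    ultimately show False
      unfolding eq e_def dist_real_def by (auto simp: abs_if split: if_splits)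
  qed
qed

text \<open>Schwarz's theorem, reduced to real values by pairing with basis vectors. For the
  directions \<open>1\<close> and \<open>\<i>\<close> it yields one of the Cauchy-Riemann equations
  of \<open>d_u X - i d_v X\<close>.\<close>

lemma symmetric_second_derivative:
  fixes f :: "'a::real_normed_vector \<Rightarrow> 'b::euclidean_space"
  assumes "open M" "z \<in> M"
    and f: "\<And>x. x \<in> M \<Longrightarrow> (f has_derivative f' x) (at x)"
    and fa: "\<And>x. x \<in> M \<Longrightarrow> ((\<lambda>x. f' x a) has_derivative fa x) (at x)"
    and fb: "\<And>x. x \<in> M \<Longrightarrow> ((\<lambda>x. f' x b) has_derivative fb x) (at x)"
    and ca: "continuous_on M (\<lambda>x. fa x b)" and cb: "continuous_on M (\<lambda>x. fb x a)"
  shows "fa z b = fb z a"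
proof (rule euclidean_eqI)
  fix i :: 'b
  note bl = bounded_linear.has_derivative[OF bounded_linear_inner_left[of i]]
  show "fa z b \<bullet> i = fb z a \<bullet> i"
    by (rule symmetric_second_derivative_real[OF assms(1,2) bl[OF f] bl[OF fa] bl[OF fb]])
      (auto intro!: continuous_intros ca cb)
qed

section \<open>Normal parts and the mean curvature vector\<close>

text \<open>Two candidates differ by a vector that is both tangent and normal, hence orthogonal to
  itself.\<close>

lemma normal_part_eqI:
  assumes "n \<in> orthogonal_comp (tangent_plane X z)" "w - n \<in> tangent_plane X z"
  shows "normal_part X z w = n"
  unfolding normal_part_def
proof (rule the_equality)
  fix m assume m: "m \<in> orthogonal_comp (tangent_plane X z) \<and> w - m \<in> tangent_plane X z"
  have "m - n \<in> tangent_plane X z"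
    using assms(2) m span_diff[of "w - n" _ "w - m"] unfolding tangent_plane_def by fastforce
  moreover have "m - n \<in> orthogonal_comp (tangent_plane X z)"
    using assms(1) m by (simp add: orthogonal_comp_def orthogonal_def inner_diff_right)
  ultimately have "orthogonal (m - n) (m - n)"
    unfolding orthogonal_comp_def by blast
  then show "m = n" by (simp add: orthogonal_def)
qed (use assms in auto)

text \<open>Orthogonal projection onto a span supplies the decomposition, so the description in
  \<open>normal_part\<close> is proper at every point, even where \<open>d_u X z\<close> and
  \<open>d_v X z\<close> are dependent.\<close>

lemma
  shows normal_part_orthogonal: "normal_part X z w \<in> orthogonal_comp (tangent_plane X z)"
    and diff_normal_part: "w - normal_part X z w \<in> tangent_plane X z"
proof -
  obtain y n where n: "y \<in> tangent_plane X z" "\<And>x. x \<in> tangent_plane X z \<Longrightarrow> orthogonal n x" "w = y + n"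
    using orthogonal_subspace_decomp_exists[of "{d_u X z, d_v X z}" w] unfolding tangent_plane_def by metis
  have "normal_part X z w = n"
    using n by (intro normal_part_eqI) (auto simp: orthogonal_comp_def orthogonal_commute)
  then show "normal_part X z w \<in> orthogonal_comp (tangent_plane X z)"
    "w - normal_part X z w \<in> tangent_plane X z"
    using n by (auto simp: orthogonal_comp_def orthogonal_commute)
qed

lemma normal_part_uminus: "normal_part X z (- w) = - normal_part X z w"
  using normal_part_orthogonal[where X = X and z = z and w = w]
    diff_normal_part[where X = X and z = z and w = w]
    span_neg[of "w - normal_part X z w" "{d_u X z, d_v X z}"]
  by (intro normal_part_eqI)
    (auto simp: orthogonal_comp_def orthogonal_def tangent_plane_def)

text \<open>With \<open>E = G\<close> and \<open>F = 0\<close> the formula collapses to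
  \<open>(II_uu + II_vv) / (2 E)\<close>, and \<open>E\<close> is positive.\<close>

lemma mean_curvature_vector_conformal:
  assumes "d_u X z \<bullet> d_u X z = d_v X z \<bullet> d_v X z" "d_u X z \<bullet> d_v X z = 0" "d_u X z \<noteq> 0"
  shows "mean_curvature_vector X z = 0 \<longleftrightarrow>
    normal_part X z (d_u (d_u X) z) + normal_part X z (d_v (d_v X) z) = 0"
proof -
  have "d_v X z \<noteq> 0" using assms(1,3) by auto
  then show ?thesis
    using assms by (simp add: mean_curvature_vector_def Let_def power2_eq_square flip: scaleR_add_right)
qed

lemma immersion_d_u_nonzero:
  assumes "immersion_on M X" "z \<in> M"
  shows "d_u X z \<noteq> 0"
proof
  assume "d_u X z = 0"
  have X: "X differentiable (at z)" "inj (frechet_derivative X (at z))"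
    using assms unfolding immersion_on_def by auto
  have "frechet_derivative X (at z) 1 = frechet_derivative X (at z) 0"
    using \<open>d_u X z = 0\<close> linear_frechet_derivative[OF X(1)] by (simp add: d_u_def linear_0)
  then show False using injD[OF X(2)] by fastforce
qed

text \<open>The differentiated conformality relations and the symmetry of mixed derivatives make the
  Laplacian normal; vanishing mean curvature makes it tangent. So it is zero.\<close>

lemma smooth_conformal_minimal_harmonic:
  fixes X :: "complex \<Rightarrow> 'b::euclidean_space"
  assumes "open M" "smooth_map_on X M" "conformal_minimal_immersion_on M X" "z \<in> M"
  shows "X differentiable (at z)" "d_u X differentiable (at z)" "d_v X differentiable (at z)"
    "d_v (d_u X) z = d_u (d_v X) z" "d_u (d_u X) z + d_v (d_v X) z = 0"
proof -
  have "Ck_on (Suc (Suc 0)) X M" using assms(2) unfolding smooth_map_on_def by blast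
  then have X: "\<And>x. x \<in> M \<Longrightarrow> X differentiable (at x)"
    and X': "\<And>x v. x \<in> M \<Longrightarrow> (\<lambda>x. frechet_derivative X (at x) v) differentiable (at x)"
    and cont: "\<And>v w. continuous_on M (\<lambda>x. frechet_derivative (\<lambda>x. frechet_derivative X (at x) v) (at x) w)"
    by auto
  define U where "U = d_u X"
  define V where "V = d_v X"
  have UV: "U = (\<lambda>x. frechet_derivative X (at x) 1)" "V = (\<lambda>x. frechet_derivative X (at x) \<i>)"
    by (auto simp: U_def V_def d_u_def d_v_def fun_eq_iff)
  have dU: "(U has_derivative frechet_derivative U (at x)) (at x)"
    and dV: "(V has_derivative frechet_derivative V (at x)) (at x)" if "x \<in> M" for x
    using X'[OF that] unfolding UV by (auto simp: frechet_derivative_works[symmetric])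
  show "X differentiable (at z)" "d_u X differentiable (at z)" "d_v X differentiable (at z)"
    using X X' \<open>z \<in> M\<close> unfolding U_def[symmetric] V_def[symmetric] UV by auto
  have "frechet_derivative U (at z) \<i> = frechet_derivative V (at z) 1"
  proof (rule symmetric_second_derivative[OF assms(1,4)])
    show "(X has_derivative frechet_derivative X (at x)) (at x)" if "x \<in> M" for x
      using X[OF that] by (simp add: frechet_derivative_works)
    show "((\<lambda>x. frechet_derivative X (at x) 1) has_derivative frechet_derivative U (at x)) (at x)"
      "((\<lambda>x. frechet_derivative X (at x) \<i>) has_derivative frechet_derivative V (at x)) (at x)"
      if "x \<in> M" for x
      using dU[OF that] dV[OF that] unfolding UV by auto
  qed (use cont in \<open>auto simp: UV\<close>)
  then show sym: "d_v (d_u X) z = d_u (d_v X) z"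
    by (simp add: U_def V_def d_u_def[of "d_v X"] d_v_def[of "d_u X"])
  have conf: "U x \<bullet> U x = V x \<bullet> V x" "U x \<bullet> V x = 0" if "x \<in> M" for x
    using assms(3) that unfolding conformal_minimal_immersion_on_def conformal_on_def U_def V_def by auto
  let ?u = "frechet_derivative U (at z)" and ?v = "frechet_derivative V (at z)"
  have 1: "((\<lambda>x. U x \<bullet> U x - V x \<bullet> V x) has_derivative
      (\<lambda>h. (U z \<bullet> ?u h + ?u h \<bullet> U z) - (V z \<bullet> ?v h + ?v h \<bullet> V z))) (at z)"
    by (intro has_derivative_diff has_derivative_inner dU dV assms)
  have 2: "((\<lambda>x. U x \<bullet> V x) has_derivative (\<lambda>h. U z \<bullet> ?v h + ?u h \<bullet> V z)) (at z)"
    by (intro has_derivative_inner dU dV assms)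
  have z: "f' = (\<lambda>_. 0)" if "(f has_derivative f') (at z)" "\<And>x. x \<in> M \<Longrightarrow> f x = 0" for f :: "complex \<Rightarrow> real" and f'
  proof -
    have "((\<lambda>_. 0) has_derivative f') (at z)"
      by (rule has_derivative_transform_within_open[OF that(1) assms(1,4)]) (simp add: that)
    then show ?thesis using has_derivative_unique[OF _ has_derivative_const[of 0]] by blast
  qed
  have E: "U z \<bullet> ?u h = V z \<bullet> ?v h" for h
    using z[OF 1] conf by (auto simp: fun_eq_iff inner_commute)
  have F: "U z \<bullet> ?v h + V z \<bullet> ?u h = 0" for h
    using z[OF 2] conf by (auto simp: fun_eq_iff inner_commute)
  have s: "?u \<i> = ?v 1" using sym by (simp add: d_u_def[of V] d_v_def[of U] flip: U_def V_def)
  let ?H = "d_u (d_u X) z + d_v (d_v X) z"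
  have H: "?H = ?u 1 + ?v \<i>" by (simp add: d_u_def[of U] d_v_def[of V] flip: U_def V_def)
  \<comment> \<open>With \<open>?u \<i> = ?v 1\<close>, the relations \<open>E\<close> at
    \<open>1\<close> and \<open>F\<close> at \<open>\<i>\<close> give the first orthogonality,
    \<open>F\<close> at \<open>1\<close> and \<open>E\<close> at \<open>\<i>\<close> the
    second.\<close>
  have HU: "U z \<bullet> ?H = 0" "V z \<bullet> ?H = 0"
    using E[of 1] E[of \<i>] F[of 1] F[of \<i>] s unfolding H by (simp_all add: inner_add_right)
  have nz: "d_u X z \<noteq> 0" and mc: "mean_curvature_vector X z = 0"
    using assms(3,4) immersion_d_u_nonzero unfolding conformal_minimal_immersion_on_def by blast+
  \<comment> \<open>The normal parts of the two second derivatives cancel, so their sum equals the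
    sum of the tangential parts.\<close>
  have "normal_part X z (d_u (d_u X) z) + normal_part X z (d_v (d_v X) z) = 0"
    using mean_curvature_vector_conformal[of X z] nz mc conf[OF assms(4)] unfolding U_def V_def by simp
  moreover have "(d_u (d_u X) z - normal_part X z (d_u (d_u X) z)) +
      (d_v (d_v X) z - normal_part X z (d_v (d_v X) z)) \<in> tangent_plane X z"
    using diff_normal_part[where X = X and z = z] unfolding tangent_plane_def by (intro span_add) auto
  ultimately have "?H \<in> span {U z, V z}"
    unfolding tangent_plane_def U_def V_def by (simp add: algebra_simps)
  moreover have "orthogonal ?H x" if "x \<in> {U z, V z}" for x
    using that HU by (auto simp: orthogonal_def inner_commute)
  ultimately have "orthogonal ?H ?H"
    using orthogonal_to_span by blast
  then show "?H = 0" by (simp add: orthogonal_def)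
qed


subsection \<open>Factorization of null quaternions\<close>

lemma cquat_vec_nth [simp]:
  "cquat_vec q $ 1 = Q0 q" "cquat_vec q $ 2 = Q1 q" "cquat_vec q $ 3 = Q2 q" "cquat_vec q $ 4 = Q3 q"
  unfolding cquat_vec_def vector_def by simp_all

lemma cquat_holomorphic_on_iff:
  "cquat_holomorphic_on F M \<longleftrightarrow>
     (\<lambda>z. Q0 (F z)) holomorphic_on M \<and> (\<lambda>z. Q1 (F z)) holomorphic_on M \<and>
     (\<lambda>z. Q2 (F z)) holomorphic_on M \<and> (\<lambda>z. Q3 (F z)) holomorphic_on M"
  by (simp add: cquat_holomorphic_on_def forall_4)

lemma cquat_holomorphic_on_const: "cquat_holomorphic_on (\<lambda>_. q) M"
  by (simp add: cquat_holomorphic_on_iff)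

lemma cquat_holomorphic_on_mult:
  assumes "cquat_holomorphic_on F M" "cquat_holomorphic_on G M"
  shows "cquat_holomorphic_on (\<lambda>z. F z * G z) M"
  using assms unfolding cquat_holomorphic_on_iff times_cquat_def
  by (auto intro!: holomorphic_intros)

lemma symnorm_mult: "symnorm (p * q) = symnorm p * symnorm q"
  by (simp add: symnorm_def times_cquat_def power2_eq_square algebra_simps)

lemma symnorm_cquat_cnj [simp]: "symnorm (cquat_cnj q) = symnorm q"
  by (simp add: symnorm_def cquat_cnj_def)

lemma cquat_cnj_mult: "cquat_cnj q * q = cquat_of_complex (symnorm q)"
  by (simp add: cquat_ops cquat_eq_iff cquat_cnj_def symnorm_def cquat_of_complex_def
      power2_eq_square algebra_simps)

lemma Sp1C_cnj_inverse:
  assumes "q \<in> Sp1C"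
  shows "q * cquat_cnj q = 1" "cquat_cnj q * q = 1"
  using assms by (simp_all add: Sp1C_def mult_cquat_cnj cquat_cnj_mult cquat_of_complex_hom)

text \<open>The algebra isomorphism from \<open>M\<^sub>2(\<complex>)\<close> sending the matrix with rows \<open>(a, b)\<close> and
  \<open>(c, d)\<close> to a quaternion; it turns the determinant into \<open>symnorm\<close>.\<close>

definition cquat_of_mat :: "complex \<Rightarrow> complex \<Rightarrow> complex \<Rightarrow> complex \<Rightarrow> cquat"
  where "cquat_of_mat a b c d =
    CQuat ((a + d) / 2) (- \<i> * (a - d) / 2) ((b - c) / 2) (- \<i> * (b + c) / 2)"

lemma cquat_of_mat_mult:
  "cquat_of_mat a b c d * cquat_of_mat a' b' c' d' =
   cquat_of_mat (a * a' + b * c') (a * b' + b * d') (c * a' + d * c') (c * b' + d * d')"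
  by (simp add: cquat_of_mat_def times_cquat_def field_simps)

lemma symnorm_cquat_of_mat: "symnorm (cquat_of_mat a b c d) = a * d - b * c"
  by (simp add: cquat_of_mat_def symnorm_def power2_eq_square field_simps)

text \<open>The inverse of the isomorphism: the arguments are the matrix entries of
  \<open>q\<close>, holomorphic whenever its coordinates are.\<close>

lemma cquat_of_mat_entries:
  "cquat_of_mat (Q0 q + \<i> * Q1 q) (Q2 q + \<i> * Q3 q) (- Q2 q + \<i> * Q3 q) (Q0 q - \<i> * Q1 q) = q"
  by (simp add: cquat_of_mat_def cquat_eq_iff field_simps)

lemma cquat_of_mat_holomorphic:
  assumes "a holomorphic_on M" "b holomorphic_on M" "c holomorphic_on M" "d holomorphic_on M"
  shows "cquat_holomorphic_on (\<lambda>z. cquat_of_mat (a z) (b z) (c z) (d z)) M"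
  using assms by (auto simp: cquat_holomorphic_on_iff cquat_of_mat_def intro!: holomorphic_intros)

text \<open>The idempotent \<open>cquat_of_mat 1 0 0 0\<close> selects the first column of its left
  neighbour and the first row of its right one. So \<open>A\<close> gets the columns
  \<open>p\<close>, \<open>s\<close> and \<open>B\<close> the rows \<open>q\<close>,
  \<open>r\<close>.\<close>

lemma null_cquat_factorization_idempotent:
  assumes M: "open M" "simply_connected M" and F: "cquat_holomorphic_on F M"
    and nz: "\<And>z. z \<in> M \<Longrightarrow> F z \<noteq> 0 \<and> null_cquat (F z)"
  obtains A B where "cquat_holomorphic_on A M" "A ` M \<subseteq> Sp1C"
    "cquat_holomorphic_on B M" "B ` M \<subseteq> Sp1C"
    "\<And>z. z \<in> M \<Longrightarrow> F z = A z * cquat_of_mat 1 0 0 0 * B z"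
proof -
  define a where "a z = Q0 (F z) + \<i> * Q1 (F z)" for z
  define b where "b z = Q2 (F z) + \<i> * Q3 (F z)" for z
  define c where "c z = - Q2 (F z) + \<i> * Q3 (F z)" for z
  define d where "d z = Q0 (F z) - \<i> * Q1 (F z)" for z
  have Fm: "F z = cquat_of_mat (a z) (b z) (c z) (d z)" for z
    unfolding a_def b_def c_def d_def by (rule cquat_of_mat_entries[symmetric])
  have hol: "a holomorphic_on M" "b holomorphic_on M" "c holomorphic_on M" "d holomorphic_on M"
    using F unfolding cquat_holomorphic_on_iff a_def b_def c_def d_def
    by (auto intro!: holomorphic_intros)
  have det: "a z * d z = b z * c z" if "z \<in> M" for z
    using nz[OF that] unfolding null_cquat_def Fm symnorm_cquat_of_mat by simp
  have nz': "a z \<noteq> 0 \<or> b z \<noteq> 0 \<or> c z \<noteq> 0 \<or> d z \<noteq> 0" if "z \<in> M" for z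
    using nz[OF that] unfolding Fm by (auto simp: cquat_of_mat_def zero_cquat_def)
  show thesis
  proof (rule holomorphic_rank_one_factorization[OF M hol det nz'])
    fix p1 p2 s1 s2 q1 q2 r1 r2
    assume h: "p1 holomorphic_on M" "p2 holomorphic_on M" "s1 holomorphic_on M" "s2 holomorphic_on M"
        "q1 holomorphic_on M" "q2 holomorphic_on M" "r1 holomorphic_on M" "r2 holomorphic_on M"
      and det1: "\<And>z. z \<in> M \<Longrightarrow> p1 z * s2 z - p2 z * s1 z = 1"
        "\<And>z. z \<in> M \<Longrightarrow> q1 z * r2 z - q2 z * r1 z = 1"
      and eq: "\<And>z. z \<in> M \<Longrightarrow> a z = p1 z * q1 z \<and> b z = p1 z * q2 z \<and>
            c z = p2 z * q1 z \<and> d z = p2 z * q2 z"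
    show thesis
    proof (rule that)
      show "cquat_holomorphic_on (\<lambda>z. cquat_of_mat (p1 z) (s1 z) (p2 z) (s2 z)) M"
        "cquat_holomorphic_on (\<lambda>z. cquat_of_mat (q1 z) (q2 z) (r1 z) (r2 z)) M"
        by (intro cquat_of_mat_holomorphic h)+
      show "(\<lambda>z. cquat_of_mat (p1 z) (s1 z) (p2 z) (s2 z)) ` M \<subseteq> Sp1C"
        "(\<lambda>z. cquat_of_mat (q1 z) (q2 z) (r1 z) (r2 z)) ` M \<subseteq> Sp1C"
        using det1 by (auto simp: Sp1C_def symnorm_cquat_of_mat mult.commute)
      show "F z = cquat_of_mat (p1 z) (s1 z) (p2 z) (s2 z) * cquat_of_mat 1 0 0 0 *
          cquat_of_mat (q1 z) (q2 z) (r1 z) (r2 z)" if "z \<in> M" for z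
        using eq[OF that] by (simp add: Fm cquat_of_mat_mult)
    qed
  qed
qed

text \<open>\<open>F\<close> and \<open>L0\<close> factor through the same idempotent. Solving the
  factorization of \<open>L0\<close> for the idempotent introduces constant conjugates, which are
  absorbed into \<open>A\<close> and \<open>B\<close>.\<close>

lemma null_cquat_factorization:
  assumes M: "open M" "simply_connected M" and F: "cquat_holomorphic_on F M"
    and nz: "\<And>z. z \<in> M \<Longrightarrow> F z \<noteq> 0 \<and> null_cquat (F z)"
    and L0: "L0 \<noteq> 0" "null_cquat L0"
  obtains A B where "cquat_holomorphic_on A M" "A ` M \<subseteq> Sp1C"
    "cquat_holomorphic_on B M" "B ` M \<subseteq> Sp1C" "\<And>z. z \<in> M \<Longrightarrow> F z = A z * L0 * B z"
proof -
  let ?E = "cquat_of_mat 1 0 0 0"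
  obtain A B where AB: "cquat_holomorphic_on A M" "A ` M \<subseteq> Sp1C"
    "cquat_holomorphic_on B M" "B ` M \<subseteq> Sp1C" "\<And>z. z \<in> M \<Longrightarrow> F z = A z * ?E * B z"
    using null_cquat_factorization_idempotent[OF M F nz] by blast
  have "simply_connected (UNIV :: complex set)"
    by (intro convex_imp_simply_connected) auto
  \<comment> \<open>The idempotent case is applied to the constant map on the plane and later
    evaluated at \<open>0\<close>.\<close>
  then obtain A' B' where AB': "A' ` UNIV \<subseteq> Sp1C" "B' ` UNIV \<subseteq> Sp1C"
      "\<And>z::complex. z \<in> UNIV \<Longrightarrow> L0 = A' z * ?E * B' z"
    using null_cquat_factorization_idempotent[of UNIV "\<lambda>_. L0"] cquat_holomorphic_on_const L0
    by (metis open_UNIV)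
  define a b where "a = A' 0" and "b = B' 0"
  have ab: "a \<in> Sp1C" "b \<in> Sp1C" "L0 = a * ?E * b"
    using AB' unfolding a_def b_def by auto
  have "cquat_cnj a * L0 * cquat_cnj b = (cquat_cnj a * a) * ?E * (b * cquat_cnj b)"
    unfolding ab(3) by (simp add: mult.assoc)
  also have "\<dots> = ?E" by (simp add: Sp1C_cnj_inverse ab)
  finally have E: "?E = cquat_cnj a * L0 * cquat_cnj b" ..
  show thesis
  proof (rule that)
    show "cquat_holomorphic_on (\<lambda>z. A z * cquat_cnj a) M"
      "cquat_holomorphic_on (\<lambda>z. cquat_cnj b * B z) M"
      by (intro cquat_holomorphic_on_mult cquat_holomorphic_on_const AB)+
    show "(\<lambda>z. A z * cquat_cnj a) ` M \<subseteq> Sp1C" "(\<lambda>z. cquat_cnj b * B z) ` M \<subseteq> Sp1C"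
      using AB(2,4) ab by (auto simp: Sp1C_def symnorm_mult)
    show "F z = A z * cquat_cnj a * L0 * (cquat_cnj b * B z)" if "z \<in> M" for z
      unfolding AB(5)[OF that] E by (simp add: mult.assoc)
  qed
qed


subsection \<open>The integral representation\<close>

lemma Re_integral_rep_cong:
  assumes "\<And>z. z \<in> M \<Longrightarrow> F z = G z"
  shows "Re_integral_rep M z0 X c F \<longleftrightarrow> Re_integral_rep M z0 X c G"
proof -
  have "cquat_contour_integral \<gamma> F = cquat_contour_integral \<gamma> G" if "path_image \<gamma> \<subseteq> M" for \<gamma>
    unfolding cquat_contour_integral_def vec_eq_iff
    using assms that by (auto intro!: contour_integral_eq)
  then show ?thesis unfolding Re_integral_rep_def by metis
qed

lemma cquat_primitive:
  assumes "open M" "simply_connected M" "cquat_holomorphic_on F M"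
  obtains h :: "complex \<Rightarrow> complex ^ 4" where
    "\<And>z i. z \<in> M \<Longrightarrow> ((\<lambda>z. h z $ i) has_field_derivative cquat_vec (F z) $ i) (at z)"
proof -
  have "\<forall>i. \<exists>h. \<forall>z\<in>M. (h has_field_derivative cquat_vec (F z) $ i) (at z)"
    using assms simply_connected_eq_global_primitive[OF assms(1)]
    unfolding cquat_holomorphic_on_def by meson
  then obtain h where h: "\<And>i z. z \<in> M \<Longrightarrow> (h i has_field_derivative cquat_vec (F z) $ i) (at z)"
    by metis
  show thesis
    by (rule that[of "\<lambda>z. \<chi> i. h i z"]) (use h in simp)
qed

text \<open>Along each path the integral is the increment of the primitive \<open>h\<close>.
  Connectedness supplies a path to every \<open>z\<close>, so the condition quantified over all
  paths is never vacuous.\<close>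

lemma Re_integral_rep_primitive:
  assumes "open M" "connected M" "z0 \<in> M"
    and h: "\<And>z i. z \<in> M \<Longrightarrow> ((\<lambda>z. h z $ i) has_field_derivative cquat_vec (F z) $ i) (at z)"
  shows "Re_integral_rep M z0 X c F \<longleftrightarrow> (\<forall>z\<in>M. X z = c + Re_vec (h z - h z0))"
proof -
  have "cquat_contour_integral \<gamma> F = h (pathfinish \<gamma>) - h (pathstart \<gamma>)"
    if "valid_path \<gamma>" "path_image \<gamma> \<subseteq> M" for \<gamma>
  proof -
    have "((\<lambda>z. cquat_vec (F z) $ i) has_contour_integral
        h (pathfinish \<gamma>) $ i - h (pathstart \<gamma>) $ i) \<gamma>" for i
      by (rule contour_integral_primitive[OF has_field_derivative_at_within[OF h] that])
    then show ?thesis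
      by (simp add: cquat_contour_integral_def vec_eq_iff contour_integral_unique)
  qed
  then have eq: "cquat_contour_integral \<gamma> F = h z - h z0"
    if "valid_path \<gamma> \<and> path_image \<gamma> \<subseteq> M \<and> pathstart \<gamma> = z0 \<and> pathfinish \<gamma> = z" for \<gamma> z
    using that by simp
  have ex: "\<exists>\<gamma>. valid_path \<gamma> \<and> path_image \<gamma> \<subseteq> M \<and> pathstart \<gamma> = z0 \<and> pathfinish \<gamma> = z"
    if "z \<in> M" for z
    using connected_open_polynomial_connected[OF assms(1,2,3) that] valid_path_polynomial_function
    by blast
  show ?thesis
    unfolding Re_integral_rep_def
  proof (intro iffI ballI allI impI)
    fix z assume rep: "\<forall>z\<in>M. \<forall>\<gamma>. valid_path \<gamma> \<and> path_image \<gamma> \<subseteq> M \<and> pathstart \<gamma> = z0 \<and>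
      pathfinish \<gamma> = z \<longrightarrow> X z = c + Re_vec (cquat_contour_integral \<gamma> F)" and "z \<in> M"
    from ex[OF \<open>z \<in> M\<close>] obtain \<gamma> where \<gamma>: "valid_path \<gamma> \<and> path_image \<gamma> \<subseteq> M \<and>
      pathstart \<gamma> = z0 \<and> pathfinish \<gamma> = z" ..
    with rep \<open>z \<in> M\<close> have "X z = c + Re_vec (cquat_contour_integral \<gamma> F)" by simp
    then show "X z = c + Re_vec (h z - h z0)" unfolding eq[OF \<gamma>] .
  qed (simp add: eq)
qed

section \<open>Null holomorphic maps and conformal minimal immersions\<close>

lemma has_derivative_vecI:
  fixes f :: "'a::real_normed_vector \<Rightarrow> real ^ 'n"
  assumes "\<And>i. ((\<lambda>x. f x $ i) has_derivative (\<lambda>h. f' h $ i)) (at x within S)"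
  shows "(f has_derivative f') (at x within S)"
  using assms by (subst has_derivative_componentwise_within)
    (auto simp: Basis_vec_def inner_axis)

lemma null_cquat_sum: "null_cquat q \<longleftrightarrow> (\<Sum>i\<in>UNIV. (cquat_vec q $ i)\<^sup>2) = 0"
  by (simp add: null_cquat_def symnorm_def sum_4)

lemma cquat_vec_eq_0_iff: "q = 0 \<longleftrightarrow> (\<forall>i. cquat_vec q $ i = 0)"
  by (simp add: forall_4 cquat_eq_iff zero_cquat_def)

text \<open>The real part and half the imaginary part of the sum. For the coordinates of
  \<open>d_u X - i d_v X\<close> these are the two conformality relations.\<close>

lemma sum_squares_eq_0_iff_Re_Im:
  fixes f :: "'n::finite \<Rightarrow> complex"
  shows "(\<Sum>i\<in>UNIV. (f i)\<^sup>2) = 0 \<longleftrightarrow>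
    (\<Sum>i\<in>UNIV. Re (f i) * Re (f i)) = (\<Sum>i\<in>UNIV. Im (f i) * Im (f i)) \<and>
    (\<Sum>i\<in>UNIV. Re (f i) * Im (f i)) = 0"
  by (simp add: complex_eq_iff power2_eq_square sum_subtractf sum.distrib
      mult.commute[of "Im _" "Re _"] flip: sum_distrib_left)

text \<open>As \<open>X\<close> is a constant plus the real part of a primitive of \<open>F\<close>,
  the partial derivatives \<open>d_u X\<close> and \<open>d_v X\<close> are the real part of
  \<open>F\<close> and minus its imaginary part. Nullity of \<open>F\<close> is then conformality,
  and holomorphy gives harmonicity.\<close>

lemma Re_integral_rep_imp_conformal_minimal:
  assumes M: "open M" "connected M" "simply_connected M" "z0 \<in> M"
    and F: "cquat_holomorphic_on F M" "\<And>z. z \<in> M \<Longrightarrow> F z \<noteq> 0 \<and> null_cquat (F z)"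
    and rep: "Re_integral_rep M z0 X c F"
  shows "conformal_minimal_immersion_on M X"
proof -
  obtain h where h: "\<And>z i. z \<in> M \<Longrightarrow> ((\<lambda>z. h z $ i) has_field_derivative cquat_vec (F z) $ i) (at z)"
    using cquat_primitive[OF M(1,3) F(1)] by blast
  define f where "f i z = cquat_vec (F z) $ i" for i z
  have X: "X z = c + Re_vec (h z - h z0)" if "z \<in> M" for z
    using rep that Re_integral_rep_primitive[OF M(1,2,4) h] by blast
  have dX: "(X has_derivative (\<lambda>w. \<chi> i. Re (f i z * w))) (at z)" if "z \<in> M" for z
  proof (rule has_derivative_transform_within_open[OF _ M(1) that])
    show "((\<lambda>z. c + Re_vec (h z - h z0)) has_derivative (\<lambda>w. \<chi> i. Re (f i z * w))) (at z)"
    proof (rule has_derivative_vecI)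
      fix i
      have "((\<lambda>z. h z $ i) has_derivative (\<lambda>w. f i z * w)) (at z)"
        using has_field_derivative_imp_has_derivative[OF h[OF that]] by (simp add: f_def)
      then show "((\<lambda>z. (c + Re_vec (h z - h z0)) $ i) has_derivative (\<lambda>w. (\<chi> i. Re (f i z * w)) $ i)) (at z)"
        by (auto simp: Re_vec_def intro!: derivative_eq_intros)
    qed
  qed (simp add: X)
  then have frX: "frechet_derivative X (at z) = (\<lambda>w. \<chi> i. Re (f i z * w))" if "z \<in> M" for z
    using frechet_derivative_at[OF dX[OF that]] by simp
  have U: "d_u X z = (\<chi> i. Re (f i z))" and V: "d_v X z = (\<chi> i. - Im (f i z))" if "z \<in> M" for z
    by (simp_all add: d_u_def d_v_def frX[OF that])
  have df: "(f i has_derivative (\<lambda>w. deriv (f i) z * w)) (at z)" if "z \<in> M" for i z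
  proof -
    have "f i holomorphic_on M"
      using F(1) unfolding cquat_holomorphic_on_def f_def by simp
    from holomorphic_derivI[OF this M(1) that] show ?thesis
      by (rule has_field_derivative_imp_has_derivative)
  qed
  have dU: "(d_u X has_derivative (\<lambda>w. \<chi> i. Re (deriv (f i) z * w))) (at z)" if "z \<in> M" for z
  proof (rule has_derivative_transform_within_open[OF _ M(1) that])
    show "((\<lambda>z. \<chi> i. Re (f i z)) has_derivative (\<lambda>w. \<chi> i. Re (deriv (f i) z * w))) (at z)"
      by (rule has_derivative_vecI) (use df[OF that] in \<open>auto intro!: derivative_eq_intros\<close>)
  qed (simp add: U)
  have dV: "(d_v X has_derivative (\<lambda>w. \<chi> i. - Im (deriv (f i) z * w))) (at z)" if "z \<in> M" for z
  proof (rule has_derivative_transform_within_open[OF _ M(1) that])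
    show "((\<lambda>z. \<chi> i. - Im (f i z)) has_derivative (\<lambda>w. \<chi> i. - Im (deriv (f i) z * w))) (at z)"
      by (rule has_derivative_vecI) (use df[OF that] in \<open>auto intro!: derivative_eq_intros\<close>)
  qed (simp add: V)
  have lap: "d_v (d_v X) z = - d_u (d_u X) z" if "z \<in> M" for z
    unfolding d_u_def[of "d_u X"] d_v_def[of "d_v X"]
      frechet_derivative_at[OF dU[OF that], symmetric] frechet_derivative_at[OF dV[OF that], symmetric]
    by (simp add: vec_eq_iff)
  have null: "(\<Sum>i\<in>UNIV. (f i z)\<^sup>2) = 0" and nz: "\<exists>i. f i z \<noteq> 0" if "z \<in> M" for z
    using F(2)[OF that] unfolding null_cquat_sum cquat_vec_eq_0_iff f_def by auto
  have imm: "immersion_on M X"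
    unfolding immersion_on_def
  proof (intro ballI conjI)
    fix z assume z: "z \<in> M"
    show diff: "X differentiable (at z)" using dX[OF z] unfolding differentiable_def by blast
    \<comment> \<open>For \<open>w\<close> in the kernel all \<open>f i z * w\<close> are purely
      imaginary and their squares sum to zero, so all of them are zero, while some
      \<open>f i z\<close> is not.\<close>
    have "w = 0" if w: "frechet_derivative X (at z) w = 0" for w
    proof -
      have re: "Re (f i z * w) = 0" for i
        using w unfolding frX[OF z] by (simp add: vec_eq_iff)
      have "(\<Sum>i\<in>UNIV. (f i z * w)\<^sup>2) = (\<Sum>i\<in>UNIV. (f i z)\<^sup>2) * w\<^sup>2"
        by (simp add: power_mult_distrib sum_distrib_right)
      then have "(\<Sum>i\<in>UNIV. (f i z * w)\<^sup>2) = 0" using null[OF z] by simp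
      then have "(\<Sum>i\<in>UNIV. Im (f i z * w) * Im (f i z * w)) = 0"
        unfolding sum_squares_eq_0_iff_Re_Im re by simp
      then have "Im (f i z * w) = 0" for i
        by (subst (asm) sum_nonneg_eq_0_iff) auto
      then have "f i z * w = 0" for i
        using re by (simp add: complex_eq_iff)
      then show "w = 0" using nz[OF z] by auto
    qed
    then show "inj (frechet_derivative X (at z))"
      using linear_frechet_derivative[OF diff] by (subst linear_injective_0) auto
  qed
  have conf: "d_u X z \<bullet> d_u X z = d_v X z \<bullet> d_v X z" "d_u X z \<bullet> d_v X z = 0" if "z \<in> M" for z
    using null[OF that] unfolding sum_squares_eq_0_iff_Re_Im U[OF that] V[OF that]
    by (simp_all add: inner_vec_def sum_negf)
  have "mean_curvature_vector X z = 0" if "z \<in> M" for z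
    using mean_curvature_vector_conformal[OF conf[OF that] immersion_d_u_nonzero[OF imm that]]
    by (simp add: lap[OF that] normal_part_uminus)
  then show ?thesis
    using imm conf by (simp add: conformal_minimal_immersion_on_def conformal_on_def)
qed

text \<open>The integrand is \<open>F = d_u X - i d_v X\<close>. Its Cauchy-Riemann equations are
  the symmetry of mixed derivatives and harmonicity.\<close>

lemma conformal_minimal_imp_Re_integral_rep:
  assumes M: "open M" "connected M" "simply_connected M" "z0 \<in> M"
    and X: "smooth_map_on X M" "conformal_minimal_immersion_on M X"
  obtains F c where "cquat_holomorphic_on F M" "\<And>z. z \<in> M \<Longrightarrow> F z \<noteq> 0 \<and> null_cquat (F z)"
    "Re_integral_rep M z0 X c F"
proof -
  define f where "f z i = Complex (d_u X z $ i) (- d_v X z $ i)" for z i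
  define F where "F z = CQuat (f z 1) (f z 2) (f z 3) (f z 4)" for z
  have Ff: "cquat_vec (F z) $ i = f z i" for z i
  proof -
    have "\<forall>i. cquat_vec (F z) $ i = f z i" unfolding forall_4 by (simp add: F_def)
    then show ?thesis by simp
  qed
  note harm = smooth_conformal_minimal_harmonic[OF M(1) X]
  have lin: "l w = Re w *\<^sub>R l 1 + Im w *\<^sub>R l \<i>" if "linear l" for l :: "complex \<Rightarrow> real ^ 4" and w
  proof -
    have "w = Re w *\<^sub>R 1 + Im w *\<^sub>R \<i>" by (simp add: complex_eq_iff)
    then show ?thesis by (metis linear_add[OF that] linear_scale[OF that])
  qed
  have holF: "cquat_holomorphic_on F M"
    unfolding cquat_holomorphic_on_def Ff holomorphic_on_open[OF M(1)]
  proof (intro allI ballI)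
    fix i z assume z: "z \<in> M"
    let ?u = "frechet_derivative (d_u X) (at z)" and ?v = "frechet_derivative (d_v X) (at z)"
    have u: "(d_u X has_derivative ?u) (at z)" and v: "(d_v X has_derivative ?v) (at z)"
      using harm(2,3)[OF z] by (simp_all add: frechet_derivative_works)
    have "((\<lambda>z. f z i) has_derivative (\<lambda>w. Complex (?u w $ i) (- ?v w $ i))) (at z)"
      unfolding f_def Complex_eq
      using bounded_linear.has_derivative[OF bounded_linear_vec_nth u, of i]
        bounded_linear.has_derivative[OF bounded_linear_vec_nth v, of i]
      by (auto intro!: derivative_eq_intros)
    \<comment> \<open>The Cauchy-Riemann equations turn the real differential into multiplication by
      a complex number.\<close>
    moreover have "(\<lambda>w. Complex (?u w $ i) (- ?v w $ i)) = (*) (Complex (?u 1 $ i) (- ?v 1 $ i))"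
    proof
      fix w
      have "?u \<i> = ?v 1" using harm(4)[OF z] by (simp add: d_u_def[of "d_v X"] d_v_def[of "d_u X"])
      moreover have "?v \<i> = - ?u 1"
        using harm(5)[OF z] by (simp add: d_u_def[of "d_u X"] d_v_def[of "d_v X"] eq_neg_iff_add_eq_0 add.commute)
      ultimately show "Complex (?u w $ i) (- ?v w $ i) = Complex (?u 1 $ i) (- ?v 1 $ i) * w"
        using lin[OF has_derivative_linear[OF u], of w] lin[OF has_derivative_linear[OF v], of w]
        by (simp add: complex_eq_iff)
    qed
    ultimately show "\<exists>f'. ((\<lambda>z. f z i) has_field_derivative f') (at z)"
      unfolding has_field_derivative_def by auto
  qed
  have imm: "immersion_on M X" and conf: "conformal_on M X"
    using X(2) unfolding conformal_minimal_immersion_on_def by auto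
  have nzF: "F z \<noteq> 0 \<and> null_cquat (F z)" if z: "z \<in> M" for z
  proof
    have "\<exists>i. d_u X z $ i \<noteq> 0"
      using immersion_d_u_nonzero[OF imm z] by (simp add: vec_eq_iff)
    then show "F z \<noteq> 0"
      by (auto simp: cquat_vec_eq_0_iff Ff f_def complex_eq_iff)
    show "null_cquat (F z)"
      using conf z unfolding null_cquat_sum sum_squares_eq_0_iff_Re_Im Ff
      by (simp add: f_def conformal_on_def inner_vec_def sum_negf)
  qed
  obtain h where h: "\<And>z i. z \<in> M \<Longrightarrow> ((\<lambda>z. h z $ i) has_field_derivative cquat_vec (F z) $ i) (at z)"
    using cquat_primitive[OF M(1,3) holF] by blast
  \<comment> \<open>In each coordinate the differentials of \<open>X\<close> and of the real part of
    \<open>h\<close> are both the real part of \<open>F z\<close> times \<open>w\<close>. So the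
    difference is constant on the connected set \<open>M\<close>, which leads to
    \<open>c = X z0\<close>.\<close>
  have "((\<lambda>z. X z - Re_vec (h z)) has_derivative (\<lambda>_. 0)) (at z)" if z: "z \<in> M" for z
  proof (rule has_derivative_vecI)
    fix i
    have dX: "(X has_derivative frechet_derivative X (at z)) (at z)"
      using harm(1)[OF z] by (simp add: frechet_derivative_works)
    have "((\<lambda>z. h z $ i) has_derivative (\<lambda>w. f z i * w)) (at z)"
      using has_field_derivative_imp_has_derivative[OF h[OF z]] by (simp add: Ff)
    then have "((\<lambda>z. X z $ i - Re (h z $ i)) has_derivative
        (\<lambda>w. frechet_derivative X (at z) w $ i - Re (f z i * w))) (at z)"
      using bounded_linear.has_derivative[OF bounded_linear_vec_nth dX, of i]
      by (auto intro!: derivative_eq_intros)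
    moreover have "frechet_derivative X (at z) w $ i - Re (f z i * w) = 0" for w
      using lin[OF has_derivative_linear[OF dX], of w] by (simp add: f_def d_u_def d_v_def)
    ultimately show "((\<lambda>z. (X z - Re_vec (h z)) $ i) has_derivative (\<lambda>w. 0 $ i)) (at z)"
      by (simp add: Re_vec_def)
  qed
  then have "X z - Re_vec (h z) = X z0 - Re_vec (h z0)" if "z \<in> M" for z
    using has_derivative_zero_unique_connected[OF M(1,2) _ that M(4)] by blast
  then have "X z = X z0 + Re_vec (h z - h z0)" if "z \<in> M" for z
    using that by (simp add: Re_vec_def vec_eq_iff algebra_simps)
  then have "Re_integral_rep M z0 X (X z0) F"
    using Re_integral_rep_primitive[OF M(1,2,4) h] by blast
  with holF nzF show thesis by (rule that)
qed

theorem theorem3p8: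
  fixes M :: "complex set" and z0 :: complex and X :: "complex \<Rightarrow> real ^ 4"
  assumes "open M" and "connected M" and "simply_connected M" and "z0 \<in> M"
    and "smooth_map_on X M"
  shows "(\<forall>L0. L0 \<noteq> 0 \<and> null_cquat L0 \<longrightarrow>
            (conformal_minimal_immersion_on M X \<longleftrightarrow>
              (\<exists>A B c. cquat_holomorphic_on A M \<and> A ` M \<subseteq> Sp1C \<and>
                       cquat_holomorphic_on B M \<and> B ` M \<subseteq> Sp1C \<and>
                       Re_integral_rep M z0 X c (\<lambda>\<zeta>. A \<zeta> * L0 * B \<zeta>))))
       \<and> (conformal_minimal_immersion_on M X \<longleftrightarrow>
            (\<exists>A B L c. cquat_holomorphic_on A M \<and> A ` M \<subseteq> Sp1C \<and>
                       cquat_holomorphic_on B M \<and> B ` M \<subseteq> Sp1C \<and>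
                       cquat_holomorphic_on L M \<and> (\<forall>z\<in>M. L z \<noteq> 0 \<and> null_cquat (L z)) \<and>
                       Re_integral_rep M z0 X c (\<lambda>\<zeta>. A \<zeta> * L \<zeta> * B \<zeta>)))"
proof -
  note M = assms(1-4)
  have sufficient: "conformal_minimal_immersion_on M X"
    if AB: "cquat_holomorphic_on A M" "A ` M \<subseteq> Sp1C" "cquat_holomorphic_on B M" "B ` M \<subseteq> Sp1C"
      and L: "cquat_holomorphic_on L M" "\<And>z. z \<in> M \<Longrightarrow> L z \<noteq> 0 \<and> null_cquat (L z)"
      and rep: "Re_integral_rep M z0 X c (\<lambda>\<zeta>. A \<zeta> * L \<zeta> * B \<zeta>)" for A B L c
  proof (rule Re_integral_rep_imp_conformal_minimal[OF M _ _ rep])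
    show "cquat_holomorphic_on (\<lambda>\<zeta>. A \<zeta> * L \<zeta> * B \<zeta>) M"
      by (intro cquat_holomorphic_on_mult AB L)
    fix z assume z: "z \<in> M"
    have S: "A z \<in> Sp1C" "B z \<in> Sp1C" using AB z by auto
    \<comment> \<open>Multiplying by the conjugates undoes \<open>A z\<close> and \<open>B z\<close>
      and recovers \<open>L z\<close>, so the product cannot be zero.\<close>
    have "cquat_cnj (A z) * (A z * L z * B z) * cquat_cnj (B z)
        = (cquat_cnj (A z) * A z) * L z * (B z * cquat_cnj (B z))"
      by (simp add: mult.assoc)
    then have "cquat_cnj (A z) * (A z * L z * B z) * cquat_cnj (B z) = L z"
      by (simp add: Sp1C_cnj_inverse S)
    then have "A z * L z * B z \<noteq> 0"
      using L(2)[OF z] by (metis mult_zero_left mult_zero_right)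
    moreover have "null_cquat (A z * L z * B z)"
      using L(2)[OF z] by (simp add: null_cquat_def symnorm_mult)
    ultimately show "A z * L z * B z \<noteq> 0 \<and> null_cquat (A z * L z * B z)" ..
  qed
  have necessary: "\<exists>A B c. cquat_holomorphic_on A M \<and> A ` M \<subseteq> Sp1C \<and>
      cquat_holomorphic_on B M \<and> B ` M \<subseteq> Sp1C \<and>
      Re_integral_rep M z0 X c (\<lambda>\<zeta>. A \<zeta> * L0 * B \<zeta>)"
    if X: "conformal_minimal_immersion_on M X" and L0: "L0 \<noteq> 0" "null_cquat L0" for L0
  proof -
    obtain F c where F: "cquat_holomorphic_on F M" "\<And>z. z \<in> M \<Longrightarrow> F z \<noteq> 0 \<and> null_cquat (F z)"
      and rep: "Re_integral_rep M z0 X c F"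
      using conformal_minimal_imp_Re_integral_rep[OF M assms(5) X] by blast
    obtain A B where AB: "cquat_holomorphic_on A M" "A ` M \<subseteq> Sp1C"
      "cquat_holomorphic_on B M" "B ` M \<subseteq> Sp1C" "\<And>z. z \<in> M \<Longrightarrow> F z = A z * L0 * B z"
      using null_cquat_factorization[OF M(1,3) F L0] by blast
    have "Re_integral_rep M z0 X c (\<lambda>\<zeta>. A \<zeta> * L0 * B \<zeta>)"
      using rep Re_integral_rep_cong[OF AB(5)] by simp
    with AB show ?thesis by blast
  qed
  \<comment> \<open>A concrete nonzero null element: with it as a constant \<open>L\<close>, the
    forward direction of the second equivalence follows from \<open>necessary\<close>.\<close>
  have E: "cquat_of_mat 1 0 0 0 \<noteq> 0" "null_cquat (cquat_of_mat 1 0 0 0)"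
    by (simp_all add: null_cquat_def symnorm_cquat_of_mat) (simp add: cquat_of_mat_def zero_cquat_def)
  show ?thesis
  proof (intro conjI allI impI iffI)
    fix L0 assume L0: "L0 \<noteq> 0 \<and> null_cquat L0"
    show "conformal_minimal_immersion_on M X \<Longrightarrow> \<exists>A B c. cquat_holomorphic_on A M \<and> A ` M \<subseteq> Sp1C \<and>
      cquat_holomorphic_on B M \<and> B ` M \<subseteq> Sp1C \<and>
      Re_integral_rep M z0 X c (\<lambda>\<zeta>. A \<zeta> * L0 * B \<zeta>)"
      using necessary L0 by blast
    show "\<exists>A B c. cquat_holomorphic_on A M \<and> A ` M \<subseteq> Sp1C \<and>
      cquat_holomorphic_on B M \<and> B ` M \<subseteq> Sp1C \<and>
      Re_integral_rep M z0 X c (\<lambda>\<zeta>. A \<zeta> * L0 * B \<zeta>) \<Longrightarrow> conformal_minimal_immersion_on M X"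
      using sufficient[of _ _ "\<lambda>_. L0"] cquat_holomorphic_on_const[of L0 M] L0 by blast
  next
    assume "conformal_minimal_immersion_on M X"
    from necessary[OF this E] obtain A B c where "cquat_holomorphic_on A M" "A ` M \<subseteq> Sp1C"
      "cquat_holomorphic_on B M" "B ` M \<subseteq> Sp1C"
      "Re_integral_rep M z0 X c (\<lambda>\<zeta>. A \<zeta> * cquat_of_mat 1 0 0 0 * B \<zeta>)" by blast
    with E cquat_holomorphic_on_const[of "cquat_of_mat 1 0 0 0" M]
    show "\<exists>A B L c. cquat_holomorphic_on A M \<and> A ` M \<subseteq> Sp1C \<and>
       cquat_holomorphic_on B M \<and> B ` M \<subseteq> Sp1C \<and>
       cquat_holomorphic_on L M \<and> (\<forall>z\<in>M. L z \<noteq> 0 \<and> null_cquat (L z)) \<and>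
       Re_integral_rep M z0 X c (\<lambda>\<zeta>. A \<zeta> * L \<zeta> * B \<zeta>)"
      by (intro exI[of _ A] exI[of _ B] exI[of _ "\<lambda>_. cquat_of_mat 1 0 0 0"] exI[of _ c]) simp
  next
    assume "\<exists>A B L c. cquat_holomorphic_on A M \<and> A ` M \<subseteq> Sp1C \<and>
       cquat_holomorphic_on B M \<and> B ` M \<subseteq> Sp1C \<and>
       cquat_holomorphic_on L M \<and> (\<forall>z\<in>M. L z \<noteq> 0 \<and> null_cquat (L z)) \<and>
       Re_integral_rep M z0 X c (\<lambda>\<zeta>. A \<zeta> * L \<zeta> * B \<zeta>)"
    then show "conformal_minimal_immersion_on M X"
      using sufficient by blast
  qed
qed

end
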